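(* Let $V$ be a finite-dimensional complex vector space carrying two Lie brackets, giving Lie algebras $\mathfrak{g}=(V,[\,,\,])$ and $\mathfrak{n}=(V,\{\,,\,\})$, where $\mathfrak{g}$ is simple and $\mathfrak{n}$ is arbitrary. Suppose that the pair $(\mathfrak{g},\mathfrak{n})$ admits a post-Lie algebra structure. Then $\mathfrak{n}$ is isomorphic to $\mathfrak{g}$ as a Lie algebra.
   Context: A post-Lie algebra structure on a pair of Lie algebras $\mathfrak{g}=(V,[\,,\,])$, $\mathfrak{n}=(V,\{\,,\,\})$ with the same underlying vector space $V$ is a bilinear product $V\times V\to V$, $(x,y)\mapsto x\cdot y$, such that for all $x,y,z\in V$: (1) $x\cdot y-y\cdot x=[x,y]-\{x,y\}$; (2) $[x,y]\cdot z=x\cdot(y\cdot z)-y\cdot(x\cdot z)$; (3) $x\cdot\{y,z\}=\{x\cdot y,z\}+\{y,x\cdot z\}$. *)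

theory Defs
  imports Complex_Main
begin

(* The underlying vector space is a whole type 'v with scalar multiplication scale, so the
   same space can carry several brackets.  No finiteness of dimension is assumed here. *)

definition bilinear_product ::
  "('a::field \<Rightarrow> 'v::ab_group_add \<Rightarrow> 'v) \<Rightarrow> ('v \<Rightarrow> 'v \<Rightarrow> 'v) \<Rightarrow> bool" where
  "bilinear_product scale b \<longleftrightarrow>
     (\<forall>x. Vector_Spaces.linear scale scale (\<lambda>y. b x y)) \<and>
     (\<forall>y. Vector_Spaces.linear scale scale (\<lambda>x. b x y))"

locale lie_algebra = vector_space scale
  for scale :: "'a::field \<Rightarrow> 'v::ab_group_add \<Rightarrow> 'v" +
  fixes bracket :: "'v \<Rightarrow> 'v \<Rightarrow> 'v"
  assumes bracket_bilinear: "bilinear_product scale bracket"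
    and bracket_alternating: "bracket x x = 0"
    and jacobi: "bracket x (bracket y z) + bracket y (bracket z x) + bracket z (bracket x y) = 0"
begin

definition ideal :: "'v set \<Rightarrow> bool" where
  "ideal I \<longleftrightarrow> subspace I \<and> (\<forall>x. \<forall>y\<in>I. bracket x y \<in> I)"

end

locale simple_lie_algebra = lie_algebra +
  assumes nonabelian: "\<exists>x y. bracket x y \<noteq> 0"
    and ideal_trivial: "ideal I \<Longrightarrow> I = {0} \<or> I = UNIV"

definition lie_algebra_isomorphic ::
  "('a::field \<Rightarrow> 'v::ab_group_add \<Rightarrow> 'v) \<Rightarrow> ('v \<Rightarrow> 'v \<Rightarrow> 'v) \<Rightarrow>
   ('a \<Rightarrow> 'w::ab_group_add \<Rightarrow> 'w) \<Rightarrow> ('w \<Rightarrow> 'w \<Rightarrow> 'w) \<Rightarrow> bool" where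
  "lie_algebra_isomorphic scale1 bracket1 scale2 bracket2 \<longleftrightarrow>
     (\<exists>f. Vector_Spaces.linear scale1 scale2 f \<and> bij f \<and>
          (\<forall>x y. f (bracket1 x y) = bracket2 (f x) (f y)))"

locale post_lie_structure =
  g: lie_algebra scale bracket_g + n: lie_algebra scale bracket_n
  for scale :: "'a::field \<Rightarrow> 'v::ab_group_add \<Rightarrow> 'v"
    and bracket_g bracket_n :: "'v \<Rightarrow> 'v \<Rightarrow> 'v" +
  fixes dot :: "'v \<Rightarrow> 'v \<Rightarrow> 'v"
  assumes dot_bilinear: "bilinear_product scale dot"
    and dot_commutator: "dot x y - dot y x = bracket_g x y - bracket_n x y"
    and dot_representation: "dot (bracket_g x y) z = dot x (dot y z) - dot y (dot x z)"
    and dot_derivation: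
      "dot x (bracket_n y z) = bracket_n (dot x y) z + bracket_n y (dot x z)"

end

theory Submission
  imports Defs "HOL-Computational_Algebra.Fundamental_Theorem_Algebra"
begin

text \<open>Write \<open>L x\<close> for left multiplication \<open>y \<mapsto> x \<cdot> y\<close> and \<open>ad\<close> for the adjoint action of \<open>n\<close>; both \<open>L\<close>
  and \<open>L + ad\<close> are representations of \<open>g\<close>. If \<open>L = 0\<close>, the brackets agree. Otherwise \<open>L\<close> is faithful
  and Cartan's criterion makes \<open>tr (L x \<circ> L y)\<close> nondegenerate. A Casimir computation then shows that
  the pairing \<open>F x y = tr (L x \<circ> ad y)\<close> is not zero; its left radical is an ideal of \<open>g\<close>, so \<open>F\<close> is
  nondegenerate. This forces the Killing form of \<open>n\<close> to be nondegenerate, hence the derivations \<open>L x\<close>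
  of \<open>n\<close> are inner, \<open>L x = ad (\<phi> x)\<close>, and \<open>\<phi>\<close> is an isomorphism from \<open>g\<close> to \<open>n\<close>.\<close>

section \<open>Traces and bilinear forms\<close>

text \<open>The obstacle is that nothing is known about \<open>n\<close>, so its rigidity has to be
  drawn from \<open>g\<close>. Traces carry it across. As \<open>g\<close> is perfect, its
  representations on the space are traceless; comparing \<open>L\<close> with \<open>L + ad\<close>
  shows that \<open>ad\<close> is traceless, although \<open>n\<close> is not known to be perfect.
  By axiom (1), right multiplications are then traceless as well, which is what the Casimir
  computation contradicts if \<open>F\<close> is zero. The pairing \<open>F\<close> has one argument
  in each algebra. By axiom (3), \<open>ad (z \<cdot> y)\<close> is the commutator of
  \<open>L z\<close> and \<open>ad y\<close>. Hence \<open>F [z,x] y = - F x (z \<cdot> y)\<close>,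
  which makes the left radical an ideal, and \<open>F z {y,k}\<close> equals the Killing form of
  \<open>n\<close> at \<open>z \<cdot> y\<close> and \<open>k\<close>. So if \<open>k\<close> lies
  in the Killing radical, every \<open>{y,k}\<close> lies in the right radical of \<open>F\<close>
  and is zero; then \<open>ad k = 0\<close>, so \<open>k\<close> itself lies in that right radical
  and vanishes.\<close>

context finite_dimensional_vector_space
begin

section \<open>Linear endomorphisms and traces on invariant subspaces\<close>

abbreviation endo :: "('b \<Rightarrow> 'b) \<Rightarrow> bool" where
  "endo f \<equiv> Vector_Spaces.linear scale scale f"

lemma endo_module_hom: "endo f \<Longrightarrow> module_hom scale scale f"
  by (simp add: module_hom_eq_linear)

lemmas endo_add = module_hom.add[OF endo_module_hom]
  and endo_scale = module_hom.scale[OF endo_module_hom]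
  and endo_zero = module_hom.zero[OF endo_module_hom]
  and endo_neg = module_hom.neg[OF endo_module_hom]
  and endo_diff = module_hom.diff[OF endo_module_hom]
  and endo_sum = module_hom.sum[OF endo_module_hom]

lemmas endo_simps = endo_add endo_scale endo_zero endo_neg endo_diff endo_sum

lemma endoI:
  assumes "\<And>x y. f (x + y) = f x + f y" "\<And>c x. f (c *s x) = c *s f x"
  shows "endo f"
  using assms vector_space_axioms by (simp add: Vector_Spaces.linear_iff)

lemma endo_compose: "endo f \<Longrightarrow> endo g \<Longrightarrow> endo (\<lambda>x. f (g x))"
  by (rule endoI) (simp_all add: endo_simps)

lemma endo_plus: "endo f \<Longrightarrow> endo g \<Longrightarrow> endo (\<lambda>x. f x + g x)"
  by (rule endoI) (simp_all add: endo_simps algebra_simps)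

lemma endo_minus: "endo f \<Longrightarrow> endo g \<Longrightarrow> endo (\<lambda>x. f x - g x)"
  by (rule endoI) (simp_all add: endo_simps algebra_simps)

lemma endo_scaled: "endo f \<Longrightarrow> endo (\<lambda>x. c *s f x)"
  by (rule endoI) (simp_all add: endo_simps algebra_simps)

lemma endo_ident: "endo (\<lambda>x. x)"
  by (rule endoI) simp_all

lemma endo_funpow: "endo f \<Longrightarrow> endo (f ^^ n)"
  by (induction n) (auto intro!: endoI simp: endo_simps)

lemma endo_setsum: "(\<And>i. i \<in> I \<Longrightarrow> endo (f i)) \<Longrightarrow> endo (\<lambda>x. \<Sum>i\<in>I. f i x)"
  by (rule endoI) (simp_all add: endo_simps sum.distrib scale_sum_right)

text \<open>The trace of the restriction of \<open>f\<close> to \<open>S\<close>; subspaces enter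
  because \<open>conjugate_operator\<close> adds up traces over a decomposition. The choice of basis
  is shown to be immaterial when \<open>f\<close> is linear and maps \<open>S\<close> into
  itself.\<close>

definition trace_on :: "'b set \<Rightarrow> ('b \<Rightarrow> 'b) \<Rightarrow> 'a" where
  "trace_on S f = (let B = (SOME B. independent B \<and> span B = S)
                   in \<Sum>b\<in>B. representation B (f b) b)"

abbreviation trace :: "('b \<Rightarrow> 'b) \<Rightarrow> 'a" where
  "trace f \<equiv> trace_on UNIV f"

lemma sum_coordinates:
  assumes "independent B" "v \<in> span B"
  shows "(\<Sum>b\<in>B. representation B v b *s b) = v"
  using sum_representation_eq[OF assms finiteI_independent[OF assms(1)] order_refl] .

text \<open>Expanding \<open>f b\<close> in the chosen basis, exchanging the sums and using
  linearity of \<open>f\<close> reassembles the vectors of that basis.\<close>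

lemma trace_on_basis:
  assumes f: "endo f" and B: "independent B" "span B = S" and stable: "f ` S \<subseteq> S"
  shows "trace_on S f = (\<Sum>b\<in>B. representation B (f b) b)"
proof -
  define C where "C = (SOME C. independent C \<and> span C = S)"
  have C: "independent C" "span C = S"
    using someI_ex[of "\<lambda>C. independent C \<and> span C = S"] B unfolding C_def by blast+
  have S: "subspace S" using subspace_span[of B] B(2) by simp
  have inS: "f b \<in> S" if "b \<in> S" for b using stable that by blast
  have BS: "b \<in> S" if "b \<in> B" for b using B span_base that by blast
  have CS: "b \<in> S" if "b \<in> C" for b using C span_base that by blast
  have "(\<Sum>b\<in>B. representation B (f b) b)
      = (\<Sum>b\<in>B. representation B (\<Sum>c\<in>C. representation C (f b) c *s c) b)"
    by (intro sum.cong refl) (simp add: sum_coordinates C inS BS)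
  also have "\<dots> = (\<Sum>b\<in>B. \<Sum>c\<in>C. representation C (f b) c * representation B c b)"
    by (intro sum.cong refl)
       (simp add: representation_sum representation_scale B C subspace_scale[OF S] CS)
  also have "\<dots> = (\<Sum>c\<in>C. \<Sum>b\<in>B. representation B c b * representation C (f b) c)"
    by (subst sum.swap) (simp add: mult.commute)
  also have "\<dots> = (\<Sum>c\<in>C. representation C (f (\<Sum>b\<in>B. representation B c b *s b)) c)"
    by (intro sum.cong refl)
       (simp add: endo_simps[OF f] representation_sum representation_scale B C
          subspace_scale[OF S] inS BS CS)
  also have "\<dots> = (\<Sum>c\<in>C. representation C (f c) c)"
    by (intro sum.cong refl) (simp add: sum_coordinates B CS)
  finally show ?thesis by (simp add: trace_on_def C_def Let_def)
qed

lemma trace_on_add: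
  assumes S: "subspace S" and f: "endo f" "f ` S \<subseteq> S" and g: "endo g" "g ` S \<subseteq> S"
  shows "trace_on S (\<lambda>v. f v + g v) = trace_on S f + trace_on S g"
proof -
  obtain B where B: "independent B" "span B = S" using basis_subspace_exists[OF S] by metis
  have "b \<in> S" if "b \<in> B" for b using B span_base that by blast
  moreover have "(\<lambda>v. f v + g v) ` S \<subseteq> S" using f g subspace_add[OF S] by blast
  ultimately show ?thesis
    using f g
    by (simp add: trace_on_basis[OF _ B] endo_plus representation_add B image_subset_iff sum.distrib)
qed

lemma trace_on_scale:
  assumes S: "subspace S" and f: "endo f" "f ` S \<subseteq> S"
  shows "trace_on S (\<lambda>v. c *s f v) = c * trace_on S f"
proof -
  obtain B where B: "independent B" "span B = S" using basis_subspace_exists[OF S] by metis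
  have "b \<in> S" if "b \<in> B" for b using B span_base that by blast
  moreover have "(\<lambda>v. c *s f v) ` S \<subseteq> S" using f subspace_scale[OF S] by blast
  ultimately show ?thesis
    using f
    by (simp add: trace_on_basis[OF _ B] endo_scaled representation_scale B image_subset_iff
          sum_distrib_left)
qed

lemma trace_on_diff:
  assumes S: "subspace S" and f: "endo f" "f ` S \<subseteq> S" and g: "endo g" "g ` S \<subseteq> S"
  shows "trace_on S (\<lambda>v. f v - g v) = trace_on S f - trace_on S g"
proof -
  have "(\<lambda>v. f v - g v) ` S \<subseteq> S" using f g subspace_diff[OF S] by blast
  from trace_on_add[OF S endo_minus[OF f(1) g(1)] this g] show ?thesis by simp
qed

lemma trace_commute:
  assumes f: "endo f" and g: "endo g"
  shows "trace (\<lambda>v. f (g v)) = trace (\<lambda>v. g (f v))"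
proof -
  have *: "trace (\<lambda>v. f (g v)) =
      (\<Sum>b\<in>Basis. \<Sum>c\<in>Basis. representation Basis (g b) c * representation Basis (f c) b)"
    if f: "endo f" and g: "endo g" for f g
  proof -
    have "trace (\<lambda>v. f (g v)) = (\<Sum>b\<in>Basis. representation Basis (f (g b)) b)"
      by (rule trace_on_basis[OF endo_compose[OF f g] independent_Basis span_Basis]) simp
    also have "\<dots> = (\<Sum>b\<in>Basis. representation Basis
        (f (\<Sum>c\<in>Basis. representation Basis (g b) c *s c)) b)"
      by (simp add: sum_coordinates independent_Basis span_Basis)
    also have "\<dots> = (\<Sum>b\<in>Basis. \<Sum>c\<in>Basis. representation Basis (g b) c * representation Basis (f c) b)"
      by (intro sum.cong refl) (simp add: endo_simps[OF f] representation_sum representation_scale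
           independent_Basis span_Basis)
    finally show ?thesis .
  qed
  show ?thesis unfolding *[OF f g] *[OF g f] by (subst sum.swap) (simp add: mult.commute)
qed

lemma trace_on_scalar:
  assumes S: "subspace S"
  shows "trace_on S (\<lambda>v. c *s v) = c * of_nat (dim S)"
proof -
  obtain B where B: "independent B" "span B = S" "card B = dim S"
    using basis_subspace_exists[OF S] by metis
  have "trace_on S (\<lambda>v. c *s v) = (\<Sum>b\<in>B. representation B (c *s b) b)"
    by (rule trace_on_basis[OF endo_scaled[OF endo_ident] B(1,2)]) (use S subspace_scale in blast)
  also have "\<dots> = (\<Sum>b\<in>B. c)"
    by (intro sum.cong refl)
       (simp add: representation_scale B(1) span_base representation_basis)
  finally show ?thesis by (simp add: B mult.commute)
qed

text \<open>A basis of the image is extended to one of \<open>S\<close>. All values of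
  \<open>f\<close> have coordinates only along the image part, so the added vectors contribute
  nothing to the diagonal.\<close>

lemma trace_on_image:
  assumes S: "subspace S" and f: "endo f" and stable: "f ` S \<subseteq> S"
  shows "trace_on S f = trace_on (f ` S) f"
proof -
  have sub: "subspace (f ` S)"
    using module_hom.subspace_image[OF endo_module_hom[OF f] S] .
  obtain B where B: "independent B" "span B = f ` S" "B \<subseteq> f ` S"
    using basis_subspace_exists[OF sub] by metis
  obtain C where C: "B \<subseteq> C" "C \<subseteq> S" "independent C" "S \<subseteq> span C"
    using maximal_independent_subset_extend[OF _ B(1), of S] B(3) stable by blast
  have spC: "span C = S" using C span_subspace[OF C(2,4) S] by simp
  have fin: "finite C" using finiteI_independent[OF C(3)] .
  have rep: "representation C (f c) = representation B (f c)" if "c \<in> C" for c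
    by (rule representation_extend[OF C(3) _ C(1)]) (use B that C in auto)
  have "trace_on S f = (\<Sum>c\<in>C. representation B (f c) c)"
    using trace_on_basis[OF f C(3) spC stable] rep by simp
  also have "\<dots> = (\<Sum>c\<in>B. representation B (f c) c)"
    by (rule sum.mono_neutral_right[OF fin C(1)]) (use representation_ne_zero in blast)
  also have "\<dots> = trace_on (f ` S) f"
    by (rule trace_on_basis[symmetric, OF f B(1,2)]) (use stable in blast)
  finally show ?thesis .
qed

lemma trace_on_zero_space: "trace_on {0} f = 0"
proof -
  define B where "B = (SOME B. independent B \<and> span B = {0})"
  have "independent B \<and> span B = {0}"
    unfolding B_def by (rule someI[of _ "{}"]) (simp add: independent_empty)
  then have "B = {}"
    using span_superset[of B] dependent_zero[of B] by (auto simp: subset_singleton_iff)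
  then show ?thesis by (simp add: trace_on_def B_def[symmetric] Let_def)
qed

lemma trace_on_cong:
  assumes S: "subspace S" and eq: "\<And>v. v \<in> S \<Longrightarrow> f v = g v"
  shows "trace_on S f = trace_on S g"
proof -
  define B where "B = (SOME B. independent B \<and> span B = S)"
  have "span B = S"
  proof -
    have "\<exists>B. independent B \<and> span B = S" using basis_subspace_exists[OF S] by metis
    from someI_ex[OF this] show ?thesis unfolding B_def by blast
  qed
  then have "f b = g b" if "b \<in> B" for b using eq span_base[OF that] by simp
  then show ?thesis by (simp add: trace_on_def B_def[symmetric] Let_def)
qed

text \<open>Passing from \<open>S\<close> to its image keeps the trace, by
  \<open>trace_on_image\<close>, and lowers the exponent by one, until the space is zero.\<close>

lemma trace_on_nilpotent:
  assumes S: "subspace S" and f: "endo f" and stable: "f ` S \<subseteq> S"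
    and nil: "\<And>v. v \<in> S \<Longrightarrow> (f ^^ n) v = 0"
  shows "trace_on S f = 0"
  using S stable nil
proof (induction n arbitrary: S)
  case 0
  then have "S = {0}" using subspace_0 by fastforce
  then show ?case by (simp add: trace_on_zero_space)
next
  case (Suc n)
  have "trace_on S f = trace_on (f ` S) f"
    by (rule trace_on_image[OF Suc.prems(1) f Suc.prems(2)])
  also have "\<dots> = 0"
  proof (rule Suc.IH)
    show "subspace (f ` S)"
      using module_hom.subspace_image[OF endo_module_hom[OF f] Suc.prems(1)] .
    show "f ` f ` S \<subseteq> f ` S" using Suc.prems(2) by blast
    show "(f ^^ n) v = 0" if "v \<in> f ` S" for v
      using that Suc.prems(3) by (auto simp: funpow_swap1)
  qed
  finally show ?case .
qed

text \<open>Independence of the union follows by counting: it spans a space of dimension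
  \<open>dim A + dim C\<close> and has at most that many elements.\<close>

lemma direct_sum_basis:
  assumes A: "subspace A" and C: "subspace C" and disj: "A \<inter> C = {0}"
  obtains B1 B2 where "independent B1" "span B1 = A" "independent B2" "span B2 = C"
    "independent (B1 \<union> B2)" "B1 \<inter> B2 = {}"
proof -
  let ?S = "{x + y |x y. x \<in> A \<and> y \<in> C}"
  obtain B1 where B1: "independent B1" "span B1 = A" "card B1 = dim A" "finite B1"
    using basis_subspace_exists[OF A] by metis
  obtain B2 where B2: "independent B2" "span B2 = C" "card B2 = dim C" "finite B2"
    using basis_subspace_exists[OF C] by metis
  have sp: "span (B1 \<union> B2) = ?S" unfolding span_Un B1 B2 ..
  have "dim ?S = dim A + dim C" using dim_sums_Int[OF A C] disj by simp
  then have "card (B1 \<union> B2) \<le> dim ?S"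
    using card_Un_le[of B1 B2] B1(3) B2(3) by simp
  moreover have "B1 \<union> B2 \<subseteq> ?S" "?S \<subseteq> span (B1 \<union> B2)"
    unfolding sp[symmetric] by (rule span_superset, rule subset_refl)
  ultimately have ind: "independent (B1 \<union> B2)"
    by (intro card_le_dim_spanning[of _ ?S]) (simp_all add: B1(4) B2(4))
  have "B1 \<inter> B2 \<subseteq> A \<inter> C"
    using span_superset[of B1] span_superset[of B2] by (auto simp: B1(2) B2(2))
  then have "B1 \<inter> B2 = {}"
    using disj B1(1) dependent_zero by auto
  with that B1(1,2) B2(1,2) ind show ?thesis by blast
qed

text \<open>Serves to glue operators given on two summands into one operator on the whole
  space.\<close>

lemma direct_sum_projection:
  assumes A: "subspace A" and C: "subspace C" and disj: "A \<inter> C = {0}"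
  obtains p where "endo p" "\<forall>a\<in>A. p a = a" "\<forall>c\<in>C. p c = 0"
proof -
  interpret vector_space_pair scale scale by unfold_locales
  obtain B1 B2 where B: "span B1 = A" "span B2 = C" "independent (B1 \<union> B2)" "B1 \<inter> B2 = {}"
    using direct_sum_basis[OF A C disj] by metis
  obtain p where p: "endo p" "\<forall>b \<in> B1 \<union> B2. p b = (if b \<in> B1 then b else 0)"
    using linear_independent_extend[OF B(3), of "\<lambda>b. if b \<in> B1 then b else 0"] by blast
  have zero: "endo (\<lambda>x. 0)" by (rule endoI) simp_all
  have "p a = a" if "a \<in> A" for a
    using linear_eq_on[OF p(1) endo_ident, of a B1] p(2) B(1) that by auto
  moreover have "p c = 0" if "c \<in> C" for c
  proof (rule linear_eq_on[OF p(1) zero])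
    show "c \<in> span B2" using B(2) that by simp
    show "p b = 0" if "b \<in> B2" for b using p(2) B(4) that by auto
  qed
  ultimately show ?thesis using that p(1) by blast
qed

lemma trace_on_direct_sum:
  assumes A: "subspace A" and C: "subspace C" and disj: "A \<inter> C = {0}"
    and f: "endo f" and stable: "f ` A \<subseteq> A" "f ` C \<subseteq> C"
  shows "trace_on {x + y |x y. x \<in> A \<and> y \<in> C} f = trace_on A f + trace_on C f"
proof -
  let ?S = "{x + y |x y. x \<in> A \<and> y \<in> C}"
  obtain B1 B2 where B1: "independent B1" "span B1 = A" and B2: "independent B2" "span B2 = C"
    and ind: "independent (B1 \<union> B2)" and B12: "B1 \<inter> B2 = {}"
    using direct_sum_basis[OF A C disj] by metis
  have sp: "span (B1 \<union> B2) = ?S" unfolding span_Un B1 B2 ..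
  have fin: "finite B1" "finite B2" using B1(1) B2(1) finiteI_independent by blast+
  have fS: "f ` ?S \<subseteq> ?S"
    using stable by (fastforce simp: endo_simps[OF f])
  have "trace_on ?S f = (\<Sum>b\<in>B1 \<union> B2. representation (B1 \<union> B2) (f b) b)"
    by (rule trace_on_basis[OF f ind sp fS])
  also have "\<dots> = (\<Sum>b\<in>B1. representation (B1 \<union> B2) (f b) b) + (\<Sum>b\<in>B2. representation (B1 \<union> B2) (f b) b)"
    by (rule sum.union_disjoint[OF fin B12])
  also have "(\<Sum>b\<in>B1. representation (B1 \<union> B2) (f b) b) = (\<Sum>b\<in>B1. representation B1 (f b) b)"
    by (intro sum.cong refl, subst representation_extend[OF ind, of _ B1])
       (use B1 stable span_base in auto)
  also have "\<dots> = trace_on A f" by (rule trace_on_basis[symmetric, OF f B1(1,2) stable(1)])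
  also have "(\<Sum>b\<in>B2. representation (B1 \<union> B2) (f b) b) = (\<Sum>b\<in>B2. representation B2 (f b) b)"
    by (intro sum.cong refl, subst representation_extend[OF ind, of _ B2])
       (use B2 stable span_base in auto)
  also have "\<dots> = trace_on C f" by (rule trace_on_basis[symmetric, OF f B2(1,2) stable(2)])
  finally show ?thesis .
qed

section \<open>Bilinear products, bilinear forms and dual bases\<close>

lemma bilinear_endo:
  assumes "bilinear_product scale b"
  shows bilinear_endo_right: "endo (b x)" and bilinear_endo_left: "endo (\<lambda>x. b x v)"
  using assms unfolding bilinear_product_def by simp_all

lemma trace_add: "endo f \<Longrightarrow> endo g \<Longrightarrow> trace (\<lambda>v. f v + g v) = trace f + trace g"
  by (rule trace_on_add[OF subspace_UNIV]) auto

lemma trace_diff: "endo f \<Longrightarrow> endo g \<Longrightarrow> trace (\<lambda>v. f v - g v) = trace f - trace g"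
  by (rule trace_on_diff[OF subspace_UNIV]) auto

lemma trace_scale: "endo f \<Longrightarrow> trace (\<lambda>v. c *s f v) = c * trace f"
  by (rule trace_on_scale[OF subspace_UNIV]) auto

lemma trace_zero: "trace (\<lambda>v. 0) = 0"
  using trace_scale[OF endo_ident, of 0] by simp

lemma trace_sum:
  assumes "\<And>i. i \<in> I \<Longrightarrow> endo (f i)"
  shows "trace (\<lambda>v. \<Sum>i\<in>I. f i v) = (\<Sum>i\<in>I. trace (f i))"
  using assms
proof (induction I rule: infinite_finite_induct)
  case (insert i I)
  then show ?case by (simp add: trace_add endo_setsum)
qed (simp_all add: trace_zero)

lemma bilinear_simps:
  assumes "bilinear_product scale b"
  shows "b (x + y) v = b x v + b y v" "b (x - y) v = b x v - b y v" "b (c *s x) v = c *s b x v"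
    "b (- x) v = - b x v" "b 0 v = 0" "b (sum f A) v = (\<Sum>i\<in>A. b (f i) v)"
    "b x (v + w) = b x v + b x w" "b x (v - w) = b x v - b x w" "b x (c *s v) = c *s b x v"
    "b x (- v) = - b x v" "b x 0 = 0" "b x (sum f A) = (\<Sum>i\<in>A. b x (f i))"
  using endo_simps[OF bilinear_endo_left[OF assms]] endo_simps[OF bilinear_endo_right[OF assms]]
  by auto

lemma bilinearI:
  assumes "\<And>v. endo (\<lambda>x. b x v)" "\<And>x. endo (b x)"
  shows "bilinear_product scale b"
  using assms unfolding bilinear_product_def by simp

text \<open>Reduces the vanishing of traces to a spanning set: brackets in a perfect algebra, or
  generalized eigenvectors of an adjoint operator.\<close>

lemma trace_bilinear_eq_0:
  assumes b: "bilinear_product scale b" and G: "\<And>z. z \<in> G \<Longrightarrow> trace (b z) = 0"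
    and z: "z \<in> span G"
  shows "trace (b z) = 0"
proof -
  note end_b = bilinear_endo_right[OF b]
  have "b 0 = (\<lambda>v. 0)" "b (x + y) = (\<lambda>v. b x v + b y v)" "b (c *s x) = (\<lambda>v. c *s b x v)" for x y c
    by (auto simp: bilinear_simps[OF b])
  then have "subspace {z. trace (b z) = 0}"
    by (intro subspaceI) (simp_all add: trace_zero trace_add end_b trace_scale)
  then show ?thesis using z G span_minimal[of G "{z. trace (b z) = 0}"] by blast
qed

definition bilinear_form :: "('b \<Rightarrow> 'b \<Rightarrow> 'a) \<Rightarrow> bool" where
  "bilinear_form \<beta> \<longleftrightarrow>
    (\<forall>x y z. \<beta> (x + y) z = \<beta> x z + \<beta> y z \<and> \<beta> z (x + y) = \<beta> z x + \<beta> z y) \<and>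
    (\<forall>c x y. \<beta> (c *s x) y = c * \<beta> x y \<and> \<beta> x (c *s y) = c * \<beta> x y)"

lemma bilinear_form_simps:
  assumes "bilinear_form \<beta>"
  shows "\<beta> (x + y) z = \<beta> x z + \<beta> y z" "\<beta> z (x + y) = \<beta> z x + \<beta> z y"
    "\<beta> (c *s x) y = c * \<beta> x y" "\<beta> x (c *s y) = c * \<beta> x y"
    "\<beta> 0 y = 0" "\<beta> x 0 = 0" "\<beta> (- x) y = - \<beta> x y"
    "\<beta> (\<Sum>i\<in>I. f i) y = (\<Sum>i\<in>I. \<beta> (f i) y)" "\<beta> x (\<Sum>i\<in>I. f i) = (\<Sum>i\<in>I. \<beta> x (f i))"
proof -
  show *: "\<beta> (x + y) z = \<beta> x z + \<beta> y z" "\<beta> z (x + y) = \<beta> z x + \<beta> z y"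
    "\<beta> (c *s x) y = c * \<beta> x y" "\<beta> x (c *s y) = c * \<beta> x y" for x y z c
    using assms unfolding bilinear_form_def by auto
  show **: "\<beta> 0 y = 0" "\<beta> x 0 = 0" for x y using *(3)[of 0 0 y] *(4)[of x 0 0] by simp_all
  show "\<beta> (- x) y = - \<beta> x y" using *(1)[of x "- x" y] **(1)[of y] by (simp add: eq_neg_iff_add_eq_0 add.commute)
  show "\<beta> (\<Sum>i\<in>I. f i) y = (\<Sum>i\<in>I. \<beta> (f i) y)" "\<beta> x (\<Sum>i\<in>I. f i) = (\<Sum>i\<in>I. \<beta> x (f i))"
    by (induction I rule: infinite_finite_induct) (simp_all add: * **)
qed

lemma bilinear_form_trace:
  assumes a: "bilinear_product scale a" and b: "bilinear_product scale b"
  shows "bilinear_form (\<lambda>x y. trace (\<lambda>v. a x (b y v)))"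
  unfolding bilinear_form_def
  using trace_add[OF endo_compose[OF bilinear_endo_right[OF a] bilinear_endo_right[OF b]]
      endo_compose[OF bilinear_endo_right[OF a] bilinear_endo_right[OF b]]]
    trace_scale[OF endo_compose[OF bilinear_endo_right[OF a] bilinear_endo_right[OF b]]]
  by (simp add: bilinear_simps[OF a] bilinear_simps[OF b])

text \<open>\<open>T\<close> is the map to the dual space, with a functional recorded by its values
  on \<open>Basis\<close>. Nondegeneracy makes it injective, finite dimension makes it surjective,
  and the preimages of the basis vectors form the dual basis.\<close>

lemma bilinear_form_coordinates:
  assumes b: "bilinear_form \<beta>" and nondeg: "\<And>x. (\<And>y. \<beta> x y = 0) \<Longrightarrow> x = 0"
  obtains e where "\<And>b c. b \<in> Basis \<Longrightarrow> c \<in> Basis \<Longrightarrow> \<beta> (e c) b = (if b = c then 1 else 0)"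
proof -
  define T where "T x = (\<Sum>b\<in>Basis. \<beta> x b *s b)" for x
  have T: "endo T"
    unfolding T_def
    by (rule endoI) (simp_all add: bilinear_form_simps[OF b] scale_left_distrib sum.distrib
        scale_sum_right)
  have rep: "representation Basis (T x) c = \<beta> x c" if "c \<in> Basis" for x c
    unfolding T_def using that
    by (simp add: representation_sum representation_scale representation_basis
        independent_Basis span_Basis finite_Basis if_distrib[of "\<lambda>a. _ * a"] cong: if_cong)
  have "x = 0" if "T x = 0" for x
  proof (rule nondeg)
    fix y
    have "\<beta> x c = 0" if "c \<in> Basis" for c
      using rep[OF that, of x] \<open>T x = 0\<close> representation_zero by simp
    then have "\<beta> x (\<Sum>c\<in>Basis. representation Basis y c *s c) = 0"
      by (simp add: bilinear_form_simps[OF b])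
    then show "\<beta> x y = 0" by (simp add: sum_coordinates independent_Basis span_Basis)
  qed
  then have "inj T" unfolding module_hom.inj_iff_eq_0[OF endo_module_hom[OF T]] by blast
  then have "surj T" using linear_inj_imp_surj[OF T] by blast
  then have inv: "T (inv T c) = c" for c by (simp add: surj_f_inv_f)
  have "\<beta> (inv T c) b = (if b = c then 1 else 0)" if "b \<in> Basis" "c \<in> Basis" for b c
    using rep[OF that(1), of "inv T c"] representation_basis[OF independent_Basis that(2)] inv
    by auto
  then show ?thesis by (rule that)
qed

text \<open>Pairing with \<open>e c\<close> reads off the coordinate of \<open>y\<close> at
  \<open>c\<close>. Symmetry is not assumed because the lemma is meant for
  \<open>mixed_form\<close>.\<close>

lemma bilinear_form_nondegenerate_right:
  assumes b: "bilinear_form \<beta>" and nondeg: "\<And>x. (\<And>y. \<beta> x y = 0) \<Longrightarrow> x = 0"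
    and y: "\<And>x. \<beta> x y = 0"
  shows "y = 0"
proof -
  obtain e where e: "\<And>b c. b \<in> Basis \<Longrightarrow> c \<in> Basis \<Longrightarrow> \<beta> (e c) b = (if b = c then 1 else 0)"
    using bilinear_form_coordinates[OF b nondeg] by metis
  have y_eq: "(\<Sum>c\<in>Basis. representation Basis y c *s c) = y"
    by (rule sum_coordinates) (simp_all add: independent_Basis span_Basis)
  have "representation Basis y c = 0" if c: "c \<in> Basis" for c
  proof -
    have "\<beta> (e c) y = (\<Sum>b\<in>Basis. representation Basis y b * \<beta> (e c) b)"
      by (subst y_eq[symmetric]) (simp add: bilinear_form_simps[OF b])
    also have "\<dots> = (\<Sum>b\<in>Basis. if b = c then representation Basis y b else 0)"
      by (rule sum.cong) (simp_all add: e c)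
    also have "\<dots> = representation Basis y c" using c finite_Basis by simp
    finally show ?thesis using y by simp
  qed
  then show ?thesis using y_eq by simp
qed

lemma dual_basis_exists:
  assumes b: "bilinear_form \<beta>" and sym: "\<And>x y. \<beta> x y = \<beta> y x"
    and nondeg: "\<And>x. (\<And>y. \<beta> x y = 0) \<Longrightarrow> x = 0"
  obtains e where "\<forall>c\<in>Basis. \<beta> c (e c) = 1"
    "\<forall>x. (\<Sum>b\<in>Basis. \<beta> x (e b) *s b) = x" "\<forall>x. (\<Sum>b\<in>Basis. \<beta> b x *s e b) = x"
proof -
  obtain e where e: "\<And>b c. b \<in> Basis \<Longrightarrow> c \<in> Basis \<Longrightarrow> \<beta> (e c) b = (if b = c then 1 else 0)"
    using bilinear_form_coordinates[OF b nondeg] by metis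
  have coord: "(\<Sum>b\<in>Basis. \<beta> x (e b) *s b) = x" for x
  proof -
    have x_eq: "(\<Sum>c\<in>Basis. representation Basis x c *s c) = x"
      by (rule sum_coordinates) (simp_all add: independent_Basis span_Basis)
    have "\<beta> x (e b) = representation Basis x b" if "b \<in> Basis" for b
    proof -
      have "\<beta> x (e b) = (\<Sum>c\<in>Basis. representation Basis x c * \<beta> (e b) c)"
        by (subst x_eq[symmetric]) (simp add: bilinear_form_simps[OF b] sym)
      also have "\<dots> = (\<Sum>c\<in>Basis. if c = b then representation Basis x c else 0)"
        by (rule sum.cong) (simp_all add: e that)
      also have "\<dots> = representation Basis x b" using that finite_Basis by simp
      finally show ?thesis .
    qed
    then show ?thesis using x_eq by simp
  qed
  \<comment> \<open>Tested against an arbitrary \<open>y\<close>, the expansion of \<open>x\<close>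
    in the dual basis reduces to the expansion of \<open>y\<close> in \<open>Basis\<close>.\<close>
  have "(\<Sum>b\<in>Basis. \<beta> b x *s e b) - x = 0" for x
  proof (rule nondeg)
    fix y
    have "\<beta> (\<Sum>b\<in>Basis. \<beta> b x *s e b) y = (\<Sum>b\<in>Basis. \<beta> y (e b) * \<beta> b x)"
      by (simp add: bilinear_form_simps[OF b] mult.commute sym[of y])
    also have "\<dots> = \<beta> (\<Sum>b\<in>Basis. \<beta> y (e b) *s b) x"
      by (simp add: bilinear_form_simps[OF b])
    also have "\<dots> = \<beta> x y" by (simp add: coord sym)
    finally show "\<beta> ((\<Sum>b\<in>Basis. \<beta> b x *s e b) - x) y = 0"
      using bilinear_form_simps(1)[OF b, of _ "- x" y] bilinear_form_simps(7)[OF b, of x y] by simp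
  qed
  then have "\<forall>x. (\<Sum>b\<in>Basis. \<beta> b x *s e b) = x" by simp
  moreover have "\<forall>c\<in>Basis. \<beta> c (e c) = 1" using e sym by simp
  ultimately show ?thesis using that coord by blast
qed

section \<open>Generalized eigenspaces\<close>

lemma span_image_lessThan:
  assumes "x \<in> span (g ` {..<n::nat})"
  obtains u where "x = (\<Sum>i<n. u i *s g i)"
proof -
  have "\<exists>u. x = (\<Sum>i<n. u i *s g i)"
    using assms
  proof (induction n arbitrary: x)
    case 0
    then show ?case by simp
  next
    case (Suc n)
    then obtain k where "x - k *s g n \<in> span (g ` {..<n})"
      by (auto simp: lessThan_Suc span_breakdown_eq)
    with Suc.IH obtain u where u: "x - k *s g n = (\<Sum>i<n. u i *s g i)" by blast
    have "x = (\<Sum>i<Suc n. (u(n := k)) i *s g i)"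
      using u by (simp add: algebra_simps)
    then show ?case by blast
  qed
  with that show ?thesis by blast
qed

lemma sequence_dependent:
  obtains n where "g n \<in> span (g ` {..<n::nat})"
proof -
  have "\<exists>n. g n \<in> span (g ` {..<n})"
  proof (rule ccontr)
    assume not: "\<not> ?thesis"
    have "dim (g ` {..<n}) = n" for n
      by (induction n) (use not in \<open>auto simp: lessThan_Suc dim_insert\<close>)
    then have "Suc dimension \<le> dimension" using dim_subset_UNIV by metis
    then show False by simp
  qed
  with that show ?thesis by blast
qed

definition poly_act :: "('b \<Rightarrow> 'b) \<Rightarrow> 'a poly \<Rightarrow> 'b \<Rightarrow> 'b" where
  "poly_act f p v = (\<Sum>i\<le>degree p. coeff p i *s (f ^^ i) v)"

lemma poly_act_bound:
  assumes "degree p \<le> n"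
  shows "poly_act f p v = (\<Sum>i\<le>n. coeff p i *s (f ^^ i) v)"
  unfolding poly_act_def
  by (rule sum.mono_neutral_left) (use assms in \<open>auto simp: coeff_eq_0\<close>)

lemma poly_act_linear_factor:
  assumes f: "endo f"
  shows "poly_act f ([:- l, 1:] * q) v = f (poly_act f q v) - l *s poly_act f q v"
proof -
  \<comment> \<open>A common summation bound for \<open>q\<close> and for \<open>pCons 0 q\<close>,
    the product of \<open>q\<close> with the variable; the latter shifts the powers of
    \<open>f\<close> by one.\<close>
  have "degree ([:- l, 1:] * q) \<le> Suc (degree q)"
    by (rule order_trans[OF degree_mult_le]) simp
  then have "poly_act f ([:- l, 1:] * q) v
      = (\<Sum>i\<le>Suc (degree q). coeff (pCons 0 q) i *s (f ^^ i) v - (l * coeff q i) *s (f ^^ i) v)"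
    by (simp add: poly_act_bound algebra_simps)
  also have "\<dots> = (\<Sum>i\<le>Suc (degree q). coeff (pCons 0 q) i *s (f ^^ i) v)
      - l *s (\<Sum>i\<le>Suc (degree q). coeff q i *s (f ^^ i) v)"
    by (simp only: sum_subtractf scale_sum_right scale_scale)
  also have "(\<Sum>i\<le>Suc (degree q). coeff (pCons 0 q) i *s (f ^^ i) v) = f (poly_act f q v)"
    unfolding sum.atMost_Suc_shift poly_act_def by (simp add: endo_simps[OF f])
  also have "(\<Sum>i\<le>Suc (degree q). coeff q i *s (f ^^ i) v) = poly_act f q v"
    by (rule poly_act_bound[symmetric]) simp
  finally show ?thesis .
qed

lemma poly_act_in:
  assumes "subspace S" "f ` S \<subseteq> S" "v \<in> S"
  shows "poly_act f p v \<in> S"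
proof -
  have "(f ^^ i) v \<in> S" for i by (induction i) (use assms in auto)
  then show ?thesis
    unfolding poly_act_def using assms(1) by (intro subspace_sum subspace_scale)
qed

text \<open>Some power of \<open>f\<close> sends \<open>v\<close> into the span of the earlier
  iterates; this relation is the monic, hence nonzero, polynomial.\<close>

lemma annihilating_poly_exists: "\<exists>p. p \<noteq> 0 \<and> poly_act f p v = 0"
proof -
  obtain n where "(f ^^ n) v \<in> span ((\<lambda>i. (f ^^ i) v) ` {..<n})"
    using sequence_dependent[of "\<lambda>i. (f ^^ i) v"] .
  then obtain u where u: "(f ^^ n) v = (\<Sum>i<n. u i *s (f ^^ i) v)"
    using span_image_lessThan by blast
  define p where "p = monom 1 n - (\<Sum>i<n. monom (u i) i)"
  have c: "coeff p i = (if i = n then 1 else if i < n then - u i else 0)" for i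
    unfolding p_def by (auto simp: coeff_sum)
  then have deg: "degree p \<le> n" by (intro degree_le) auto
  have "(\<Sum>i<n. coeff p i *s (f ^^ i) v) = - (\<Sum>i<n. u i *s (f ^^ i) v)"
    unfolding sum_negf[symmetric] by (intro sum.cong refl) (simp add: c)
  then have "poly_act f p v = 0"
    unfolding poly_act_bound[OF deg] lessThan_Suc_atMost[symmetric] by (simp add: c u)
  moreover have "p \<noteq> 0" using c[of n] by auto
  ultimately show ?thesis by blast
qed

text \<open>The vector may be zero and the exponent may depend on it. That
  \<open>gen_eigen f 0 v\<close> holds for all \<open>v\<close> is the form in which nilpotency of
  \<open>f\<close> is used.\<close>

definition gen_eigen :: "('b \<Rightarrow> 'b) \<Rightarrow> 'a \<Rightarrow> 'b \<Rightarrow> bool" where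
  "gen_eigen f l v \<longleftrightarrow> (\<exists>n. ((\<lambda>w. f w - l *s w) ^^ n) v = 0)"

lemma endo_shift: "endo f \<Longrightarrow> endo (\<lambda>w. f w - l *s w)"
  by (intro endo_minus endo_scaled endo_ident)

lemma funpow_zero_mono:
  assumes "endo f" "(f ^^ m) v = 0" "m \<le> n"
  shows "(f ^^ n) v = 0"
proof -
  have "(f ^^ n) v = (f ^^ (n - m)) ((f ^^ m) v)"
    using assms(3) by (metis funpow_add le_add_diff_inverse2 o_apply)
  then show ?thesis using assms endo_zero[OF endo_funpow[OF assms(1)]] by simp
qed

lemma gen_eigen_zero: "gen_eigen f l 0"
  unfolding gen_eigen_def by (rule exI[of _ 0]) simp

lemma gen_eigen_add:
  assumes f: "endo f" and "gen_eigen f l v" "gen_eigen f l w"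
  shows "gen_eigen f l (v + w)"
proof -
  let ?g = "\<lambda>w. f w - l *s w"
  obtain m n where "(?g ^^ m) v = 0" "(?g ^^ n) w = 0" using assms gen_eigen_def by blast
  then have "(?g ^^ max m n) v = 0" "(?g ^^ max m n) w = 0"
    using funpow_zero_mono[OF endo_shift[OF f]] by (meson max.cobounded1 max.cobounded2)+
  then show ?thesis
    unfolding gen_eigen_def
    by (intro exI[of _ "max m n"]) (simp add: endo_add[OF endo_funpow[OF endo_shift[OF f]]])
qed

lemma gen_eigen_scale:
  assumes f: "endo f" and "gen_eigen f l v"
  shows "gen_eigen f l (c *s v)"
  using assms(2) unfolding gen_eigen_def
  by (auto simp: endo_scale[OF endo_funpow[OF endo_shift[OF f]]])

text \<open>The last nonzero iterate of \<open>v\<close> under \<open>f\<close> minus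
  \<open>l\<close> is a true eigenvector \<open>w\<close>. On it \<open>f\<close> minus
  \<open>m\<close> acts as the scalar \<open>l - m\<close>, yet some power of that operator kills
  \<open>v\<close>, and hence \<open>w\<close> because the two shifts commute.\<close>

lemma gen_eigen_disjoint:
  assumes f: "endo f" and l: "gen_eigen f l v" and m: "gen_eigen f m v" and v: "v \<noteq> 0"
  shows "l = m"
proof (rule ccontr)
  assume lm: "l \<noteq> m"
  let ?g = "\<lambda>w. f w - l *s w" and ?h = "\<lambda>w. f w - m *s w"
  define P where "P j = ((?g ^^ j) v = 0)" for j
  have ex: "\<exists>j. P j" using l unfolding gen_eigen_def P_def .
  define j where "j = (LEAST j. P j)"
  have Pj: "P j" unfolding j_def using ex by (rule LeastI_ex)
  have "j \<noteq> 0" using Pj v unfolding P_def by (metis funpow_0)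
  then obtain i where i: "j = Suc i" using not0_implies_Suc by blast
  have "\<not> P i" using not_less_Least[of i P] i j_def by simp
  define w where "w = (?g ^^ i) v"
  have w: "w \<noteq> 0" "f w = l *s w" using \<open>\<not> P i\<close> Pj by (simp_all add: w_def P_def i)
  obtain k where k: "(?h ^^ k) v = 0" using m gen_eigen_def by blast
  have comm: "?h (?g x) = ?g (?h x)" for x
    by (simp add: endo_simps[OF f] algebra_simps)
  have commg: "?h ((?g ^^ a) x) = (?g ^^ a) (?h x)" for a x
    by (induction a) (simp_all only: funpow.simps o_apply id_apply comm)
  have commh: "(?h ^^ b) ((?g ^^ a) x) = (?g ^^ a) ((?h ^^ b) x)" for a b x
    by (induction b) (simp_all only: funpow.simps o_apply id_apply commg)
  have "(?h ^^ k) w = 0"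
    unfolding w_def commh k by (rule endo_zero[OF endo_funpow[OF endo_shift[OF f]]])
  moreover have "(?h ^^ k) w = (l - m) ^ k *s w"
  proof (induction k)
    case (Suc k)
    show ?case by (simp add: Suc endo_scale[OF f] w algebra_simps)
  qed simp
  ultimately show False using w lm by simp
qed

text \<open>The kernels of the powers grow with bounded dimension, so they stabilize at some
  \<open>n\<close>. Stability gives the trivial intersection and makes \<open>g ^^ n\<close>
  bijective on \<open>C\<close>; subtracting the element of \<open>C\<close> with the same image
  splits any vector of \<open>S\<close>.\<close>

lemma fitting_decomposition:
  assumes g: "endo g" and S: "subspace S" and stable: "g ` S \<subseteq> S"
  obtains n A C where "A = {v \<in> S. (g ^^ n) v = 0}" "C = (g ^^ n) ` S"
    "A \<inter> C = {0}" "S = {x + y |x y. x \<in> A \<and> y \<in> C}"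
    "\<forall>v\<in>S. \<forall>k. (g ^^ k) v = 0 \<longrightarrow> v \<in> A"
proof -
  note gn = endo_funpow[OF g]
  define K where "K m = {v \<in> S. (g ^^ m) v = 0}" for m
  have subK: "subspace (K m)" for m
    unfolding K_def
    using S by (auto intro!: subspaceI simp: endo_simps[OF gn] subspace_0 subspace_add subspace_scale)
  have mono: "K m \<subseteq> K k" if "m \<le> k" for m k
    unfolding K_def using funpow_zero_mono[OF g _ that] by blast
  obtain n where n: "\<And>m. dim (K m) \<le> dim (K n)"
    using ex_has_greatest_nat[of "\<lambda>_. True" 0 "\<lambda>m. dim (K m)" "Suc dimension"] dim_subset_UNIV
    by (auto simp: less_Suc_eq_le)
  have stab: "K m \<subseteq> K n" for m
  proof -
    have "K n = K (max m n)"
      by (rule subspace_dim_equal[OF subK subK mono n]) simp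
    then show ?thesis using mono[of m "max m n"] by simp
  qed
  define C where "C = (g ^^ n) ` S"
  have gS: "(g ^^ k) v \<in> S" if "v \<in> S" for k v
    by (induction k) (use that stable in auto)
  have subC: "subspace C"
    unfolding C_def using module_hom.subspace_image[OF endo_module_hom[OF gn] S] .
  have CS: "C \<subseteq> S" unfolding C_def using gS by blast
  have disj: "K n \<inter> C = {0}"
  proof -
    have "v = 0" if vK: "v \<in> K n" and vC: "v \<in> C" for v
    proof -
      obtain w where w: "w \<in> S" "v = (g ^^ n) w" using vC C_def by blast
      then have "w \<in> K (n + n)" using vK by (simp add: K_def funpow_add)
      then show ?thesis using stab w K_def by blast
    qed
    then show ?thesis using subspace_0[OF subK] subspace_0[OF subC] by blast
  qed
  have onto: "(g ^^ n) ` C = C"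
  proof (rule subspace_dim_equal[OF module_hom.subspace_image[OF endo_module_hom[OF gn] subC] subC])
    interpret finite_dimensional_vector_space_pair scale Basis scale Basis by unfold_locales
    show "(g ^^ n) ` C \<subseteq> C" unfolding C_def using gS by blast
    have "inj_on (g ^^ n) C"
      unfolding module_hom.inj_on_iff_eq_0[OF endo_module_hom[OF gn] subC]
      using disj CS K_def by blast
    then have "dim ((g ^^ n) ` C) = dim C"
      by (intro dim_image_eq[OF gn]) (simp add: span_eq_iff[THEN iffD2, OF subC])
    then show "dim C \<le> dim ((g ^^ n) ` C)" by simp
  qed
  have "\<exists>x y. v = x + y \<and> x \<in> K n \<and> y \<in> C" if v: "v \<in> S" for v
  proof -
    have "(g ^^ n) v \<in> (g ^^ n) ` C" unfolding onto using v C_def by blast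
    then obtain c where c: "c \<in> C" "(g ^^ n) v = (g ^^ n) c" by blast
    then have "v - c \<in> K n"
      using v CS subspace_diff[OF S] by (auto simp: K_def endo_simps[OF gn])
    then show ?thesis using c(1) by (intro exI[of _ "v - c"] exI[of _ c]) simp
  qed
  moreover have "x + y \<in> S" if "x \<in> K n" "y \<in> C" for x y
    using that CS subspace_add[OF S] K_def by blast
  ultimately have sum: "S = {x + y |x y. x \<in> K n \<and> y \<in> C}" by blast
  have "\<forall>v\<in>S. \<forall>k. (g ^^ k) v = 0 \<longrightarrow> v \<in> K n" using stab K_def by blast
  with that[OF K_def C_def disj sum] show ?thesis .
qed

end

section \<open>Complex scalars: eigenvectors and conjugate eigenvalues\<close>

locale finite_dimensional_complex_space = finite_dimensional_vector_space scale Basis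
  for scale :: "complex \<Rightarrow> 'v::ab_group_add \<Rightarrow> 'v" (infixr "*s" 75) and Basis
begin

text \<open>Take an annihilating polynomial of \<open>v\<close> of least degree and split off a root
  \<open>l\<close>. The cofactor does not annihilate \<open>v\<close>, by minimality, so it turns
  \<open>v\<close> into an eigenvector for \<open>l\<close>.\<close>

lemma eigenvector_exists:
  assumes f: "endo f" and S: "subspace S" and stable: "f ` S \<subseteq> S" and "S \<noteq> {0}"
  obtains l v where "v \<in> S" "v \<noteq> 0" "f v = l *s v"
proof -
  obtain v where v: "v \<in> S" "v \<noteq> 0" using subspace_0[OF S] \<open>S \<noteq> {0}\<close> by blast
  define P where "P p \<longleftrightarrow> p \<noteq> 0 \<and> poly_act f p v = 0" for p
  obtain p where p: "P p" and least: "\<And>q. P q \<Longrightarrow> degree p \<le> degree q"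
    using ex_has_least_nat[of P _ degree] annihilating_poly_exists[of f v] unfolding P_def by blast
  have "degree p \<noteq> 0"
  proof
    assume "degree p = 0"
    then obtain c where "p = [:c:]" by (rule degree_eq_zeroE)
    then show False using p v(2) unfolding P_def poly_act_def by simp
  qed
  then obtain l where "poly p l = 0"
    using fundamental_theorem_of_algebra[of p] constant_degree[of p] by auto
  then obtain q where q: "p = [:- l, 1:] * q" unfolding poly_eq_0_iff_dvd dvd_def by blast
  have q0: "q \<noteq> 0" using p q unfolding P_def by auto
  then have "degree q < degree p" unfolding q by (subst degree_mult_eq) auto
  then have "poly_act f q v \<noteq> 0" using least[of q] q0 unfolding P_def by auto
  moreover have "f (poly_act f q v) = l *s poly_act f q v"
    using p poly_act_linear_factor[OF f, of l q v] unfolding P_def q by simp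
  ultimately show ?thesis using that poly_act_in[OF S stable v(1)] by blast
qed

text \<open>Here \<open>r\<close> is the sum of the squared absolute values of the eigenvalues with
  multiplicity, so \<open>r = 0\<close> means nilpotency. All claims are bundled so that one
  induction proves them: split off the generalized eigenspace \<open>A\<close> of one eigenvalue and
  recurse on its Fitting complement \<open>C\<close>.\<close>

lemma conjugate_operator:
  assumes f: "endo f" and S: "subspace S" and stable: "f ` S \<subseteq> S"
  shows "\<exists>y r. endo y \<and> y ` S \<subseteq> S \<and> (\<forall>l v. v \<in> S \<longrightarrow> gen_eigen f l v \<longrightarrow> y v = cnj l *s v)
    \<and> trace_on S (\<lambda>v. y (f v)) = of_real r \<and> r \<ge> 0 \<and> (r = 0 \<longrightarrow> (\<forall>v\<in>S. gen_eigen f 0 v))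
    \<and> S \<subseteq> span {v \<in> S. \<exists>l. gen_eigen f l v}"
  using S stable
proof (induction "dim S" arbitrary: S rule: less_induct)
  case less
  note S = less.prems(1)
  show ?case
  proof (cases "S = {0}")
    case True
    have "endo (\<lambda>v. 0)" by (rule endoI) simp_all
    then show ?thesis
      using True gen_eigen_zero span_zero
      by (intro exI[of _ "\<lambda>v. 0"] exI[of _ 0]) (auto simp: trace_on_zero_space)
  next
    case False
    obtain l w where w: "w \<in> S" "w \<noteq> 0" "f w = l *s w"
      using eigenvector_exists[OF f S less.prems(2) False] .
    define g where "g = (\<lambda>v. f v - l *s v)"
    have g: "endo g" unfolding g_def by (rule endo_shift[OF f])
    have gS: "g ` S \<subseteq> S"
      using less.prems(2) subspace_diff[OF S] subspace_scale[OF S] unfolding g_def by blast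
    obtain A n C where A: "A = {v \<in> S. (g ^^ n) v = 0}" and C: "C = (g ^^ n) ` S"
      and disj: "A \<inter> C = {0}" and sum: "S = {x + y |x y. x \<in> A \<and> y \<in> C}"
      and max: "\<forall>v\<in>S. \<forall>k. (g ^^ k) v = 0 \<longrightarrow> v \<in> A"
      using fitting_decomposition[OF g S gS] .
    note gn = endo_funpow[OF g]
    have subA: "subspace A"
      unfolding A using S
      by (auto intro!: subspaceI simp: endo_simps[OF gn] subspace_0 subspace_add subspace_scale)
    have subC: "subspace C"
      unfolding C using module_hom.subspace_image[OF endo_module_hom[OF gn] S] .
    have gnf: "(g ^^ k) (f v) = f ((g ^^ k) v)" for k v
      by (induction k) (simp_all add: g_def endo_simps[OF f])
    have fA: "f ` A \<subseteq> A"
      using less.prems(2) by (auto simp: A gnf endo_zero[OF f])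
    have fC: "f ` C \<subseteq> C"
      using less.prems(2) by (auto simp: C gnf[symmetric])
    have funS: "(g ^^ k) v \<in> S" if "v \<in> S" for k v
      by (induction k) (use that gS in auto)
    have AS: "A \<subseteq> S" unfolding A by blast
    have CS: "C \<subseteq> S" unfolding C by (auto intro: funS)
    \<comment> \<open>The eigenvector lies in \<open>A\<close>, so \<open>C\<close> is strictly
      smaller and the induction hypothesis applies.\<close>
    have "w \<in> A" using max[rule_format, OF w(1), of 1] w by (simp add: g_def)
    then have "w \<notin> C" using disj w(2) by blast
    then have "dim C < dim S"
      using subspace_dim_equal[OF subC S CS] w(1) by (metis not_less)
    from less.hyps[OF this subC fC] obtain y' r'
      where y': "endo y'" "y' ` C \<subseteq> C" "\<And>l v. v \<in> C \<Longrightarrow> gen_eigen f l v \<Longrightarrow> y' v = cnj l *s v"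
        and tr': "trace_on C (\<lambda>v. y' (f v)) = of_real r'" and r': "r' \<ge> 0"
          "r' = 0 \<longrightarrow> (\<forall>v\<in>C. gen_eigen f 0 v)"
        and spC: "C \<subseteq> span {v \<in> C. \<exists>l. gen_eigen f l v}"
      by blast
    obtain p where p: "endo p" "\<forall>a\<in>A. p a = a" "\<forall>c\<in>C. p c = 0"
      using direct_sum_projection[OF subA subC disj] .
    \<comment> \<open>The projection glues \<open>cnj l\<close> on \<open>A\<close> to
      \<open>y'\<close> on \<open>C\<close>, giving an operator that is linear on the whole
      space.\<close>
    define y where "y = (\<lambda>v. cnj l *s p v + y' (v - p v))"
    have y: "endo y"
      unfolding y_def
      by (intro endo_plus endo_scaled p(1) endo_compose[OF y'(1)] endo_minus endo_ident)
    have yA: "y a = cnj l *s a" if "a \<in> A" for a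
      using p(2) that by (simp add: y_def endo_zero[OF y'(1)])
    have yC: "y c = y' c" if "c \<in> C" for c
      using p(3) that by (simp add: y_def)
    have yA': "y ` A \<subseteq> A" using yA subspace_scale[OF subA] by auto
    have yC': "y ` C \<subseteq> C" using yC y'(2) by auto
    have yS: "y ` S \<subseteq> S"
    proof -
      have "y (a + c) \<in> S" if "a \<in> A" "c \<in> C" for a c
        unfolding endo_add[OF y] using that yA' yC' AS CS subspace_add[OF S] by blast
      then show ?thesis using sum by blast
    qed
    have genA: "gen_eigen f l a" if "a \<in> A" for a
      using that unfolding A gen_eigen_def g_def by blast
    \<comment> \<open>Both components of \<open>v\<close> are killed by the same power, because
      \<open>A\<close> and \<open>C\<close> are stable and meet only in zero. A nonzero component in
      \<open>A\<close> forces \<open>m = l\<close>.\<close>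
    have eig: "y v = cnj m *s v" if "v \<in> S" and m: "gen_eigen f m v" for m v
    proof -
      obtain a c where v: "v = a + c" and ac: "a \<in> A" "c \<in> C" using \<open>v \<in> S\<close> sum by blast
      let ?h = "\<lambda>w. f w - m *s w"
      obtain k where k: "(?h ^^ k) v = 0" using m unfolding gen_eigen_def by blast
      have hA: "(?h ^^ k) a \<in> A" for k
        by (induction k) (use ac fA subspace_diff[OF subA] subspace_scale[OF subA] in auto)
      have hC: "(?h ^^ k) c \<in> C" for k
        by (induction k) (use ac fC subspace_diff[OF subC] subspace_scale[OF subC] in auto)
      have eq: "(?h ^^ k) a + (?h ^^ k) c = 0"
        using k unfolding v endo_add[OF endo_funpow[OF endo_shift[OF f]]] .
      then have "(?h ^^ k) a = - (?h ^^ k) c" by (simp add: eq_neg_iff_add_eq_0)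
      then have "(?h ^^ k) a \<in> C" using subspace_neg[OF subC hC] by simp
      then have a0: "(?h ^^ k) a = 0" using hA disj by blast
      then have c0: "(?h ^^ k) c = 0" using eq by simp
      have "y' c = cnj m *s c" using y'(3)[OF ac(2)] c0 gen_eigen_def by blast
      moreover have "cnj l *s a = cnj m *s a"
        using gen_eigen_disjoint[OF f genA[OF ac(1)], of m] a0 gen_eigen_def by (cases "a = 0") auto
      ultimately show ?thesis
        by (simp add: v endo_add[OF y] yA yC ac scale_right_distrib)
    qed
    \<comment> \<open>On \<open>A\<close> the operator is \<open>l\<close> plus the nilpotent
      \<open>g\<close>, so only the scalar part contributes.\<close>
    have "trace_on A f = trace_on A (\<lambda>v. g v + l *s v)"
      by (simp add: g_def)
    also have "\<dots> = trace_on A g + trace_on A (\<lambda>v. l *s v)"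
      by (rule trace_on_add[OF subA g _ endo_scaled[OF endo_ident]])
         (use fA subspace_diff[OF subA] subspace_scale[OF subA] in \<open>auto simp: g_def\<close>)
    also have "trace_on A g = 0"
      by (rule trace_on_nilpotent[OF subA g, of n])
         (use fA subspace_diff[OF subA] subspace_scale[OF subA] in \<open>auto simp: g_def A\<close>)
    finally have trAf: "trace_on A f = l * of_nat (dim A)" by (simp add: trace_on_scalar[OF subA])
    have "trace_on A (\<lambda>v. y (f v)) = trace_on A (\<lambda>v. cnj l *s f v)"
      by (rule trace_on_cong[OF subA], rule yA) (use fA in blast)
    also have "\<dots> = cnj l * (l * of_nat (dim A))"
      using trace_on_scale[OF subA f fA] trAf by simp
    also have "\<dots> = of_real ((cmod l)\<^sup>2 * dim A)"
      by (simp add: complex_norm_square mult_ac del: of_real_power)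
    finally have trA: "trace_on A (\<lambda>v. y (f v)) = of_real ((cmod l)\<^sup>2 * dim A)" .
    have "trace_on C (\<lambda>v. y (f v)) = trace_on C (\<lambda>v. y' (f v))"
      by (rule trace_on_cong[OF subC], rule yC) (use fC in blast)
    then have trC: "trace_on C (\<lambda>v. y (f v)) = of_real r'" using tr' by simp
    have "trace_on S (\<lambda>v. y (f v)) = trace_on A (\<lambda>v. y (f v)) + trace_on C (\<lambda>v. y (f v))"
      unfolding sum
      by (rule trace_on_direct_sum[OF subA subC disj endo_compose[OF y f]]) (use fA fC yA' yC' in blast)+
    then have tr: "trace_on S (\<lambda>v. y (f v)) = of_real ((cmod l)\<^sup>2 * dim A + r')"
      unfolding trA trC by simp
    have nil: "gen_eigen f 0 v" if zero: "(cmod l)\<^sup>2 * dim A + r' = 0" and "v \<in> S" for v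
    proof -
      have "(cmod l)\<^sup>2 * dim A = 0" "r' = 0"
        using zero r'(1) by (auto simp: add_nonneg_eq_0_iff)
      moreover have "dim A \<noteq> 0" using \<open>w \<in> A\<close> w(2) by auto
      ultimately have "l = 0" "r' = 0" by auto
      moreover obtain a c where "v = a + c" "a \<in> A" "c \<in> C" using \<open>v \<in> S\<close> sum by blast
      ultimately show ?thesis using gen_eigen_add[OF f] genA r'(2) by blast
    qed
    have "S \<subseteq> span {v \<in> S. \<exists>l. gen_eigen f l v}" (is "_ \<subseteq> span ?G")
    proof -
      have "A \<subseteq> ?G" using genA AS by auto
      then have "A \<subseteq> span ?G" using span_superset[of ?G] by (rule order_trans)
      moreover have "C \<subseteq> span ?G"
        by (rule order_trans[OF spC span_mono]) (use CS in auto)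
      ultimately have "a + c \<in> span ?G" if "a \<in> A" "c \<in> C" for a c
        using that by (intro span_add) auto
      then show ?thesis by (subst sum) blast
    qed
    then show ?thesis
      using y yS eig tr nil r'(1)
      by (intro exI[of _ y] exI[of _ "(cmod l)\<^sup>2 * dim A + r'"]) auto
  qed
qed

end

section \<open>Representations of Lie algebras\<close>

locale complex_lie_algebra = finite_dimensional_complex_space scale Basis + lie_algebra scale bracket
  for scale :: "complex \<Rightarrow> 'v::ab_group_add \<Rightarrow> 'v" (infixr "*s" 75) and Basis bracket
begin

lemmas bracket_simps = bilinear_simps[OF bracket_bilinear]

lemma bracket_antisym: "bracket y x = - bracket x y"
proof -
  have "bracket (x + y) (x + y) = 0" by (rule bracket_alternating)
  then show ?thesis
    unfolding bracket_simps by (simp add: bracket_alternating eq_neg_iff_add_eq_0 add.commute)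
qed

text \<open>The module is the underlying space itself, which suits the adjoint action and left
  multiplication by a product.\<close>

definition lie_rep :: "('v \<Rightarrow> 'v \<Rightarrow> 'v) \<Rightarrow> bool" where
  "lie_rep \<rho> \<longleftrightarrow> bilinear_product scale \<rho> \<and>
     (\<forall>x y v. \<rho> (bracket x y) v = \<rho> x (\<rho> y v) - \<rho> y (\<rho> x v))"

lemma lie_rep_bilinear: "lie_rep \<rho> \<Longrightarrow> bilinear_product scale \<rho>"
  unfolding lie_rep_def by simp

lemma lie_rep_bracket: "lie_rep \<rho> \<Longrightarrow> \<rho> (bracket x y) v = \<rho> x (\<rho> y v) - \<rho> y (\<rho> x v)"
  unfolding lie_rep_def by simp

lemma lie_rep_adjoint: "lie_rep bracket"
proof -
  have "bracket (bracket x y) v = bracket x (bracket y v) - bracket y (bracket x v)" for x y v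
    using jacobi[of x y v] bracket_antisym[of v "bracket x y"] bracket_antisym[of v x]
    by (simp add: bracket_simps algebra_simps eq_neg_iff_add_eq_0)
  then show ?thesis unfolding lie_rep_def using bracket_bilinear by blast
qed

text \<open>Weights add: shifting \<open>\<rho> x\<close> by \<open>l + m\<close> acts on
  \<open>\<rho> a v\<close> by the Leibniz rule, as the \<open>m\<close>-shift of
  \<open>bracket x\<close> on \<open>a\<close> plus the \<open>l\<close>-shift of
  \<open>\<rho> x\<close> on \<open>v\<close>. Each application lowers one of the two
  exponents.\<close>

lemma gen_eigen_lie_rep:
  assumes rep: "lie_rep \<rho>" and a: "gen_eigen (bracket x) m a" and v: "gen_eigen (\<rho> x) l v"
  shows "gen_eigen (\<rho> x) (l + m) (\<rho> a v)"
proof -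
  note b = lie_rep_bilinear[OF rep]
  note e = bilinear_endo_right[OF b]
  let ?g = "\<lambda>w. \<rho> x w - l *s w" and ?h = "\<lambda>w. bracket x w - m *s w"
    and ?k = "\<lambda>w. \<rho> x w - (l + m) *s w"
  obtain i j where ij: "(?h ^^ i) a = 0" "(?g ^^ j) v = 0" using a v unfolding gen_eigen_def by blast
  have "(?k ^^ (i + j)) (\<rho> a v) = 0"
    using ij
  proof (induction "i + j" arbitrary: i j a v)
    case 0
    then show ?case by (simp add: bilinear_simps[OF b])
  next
    case (Suc n)
    show ?case
    proof (cases "i = 0 \<or> j = 0")
      case True
      then have "\<rho> a v = 0" using Suc.prems by (auto simp: bilinear_simps[OF b])
      then show ?thesis using endo_zero[OF endo_funpow[OF endo_shift[OF e]]] by simp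
    next
      case False
      then obtain i' j' where i': "i = Suc i'" and j': "j = Suc j'" by (metis not0_implies_Suc)
      have 1: "(?k ^^ (i' + j)) (\<rho> (?h a) v) = 0"
        by (rule Suc.hyps(1))
           (use Suc.hyps(2) Suc.prems(2) Suc.prems(1)[unfolded i' funpow_Suc_right o_apply] i' in auto)
      have 2: "(?k ^^ (i + j')) (\<rho> a (?g v)) = 0"
        by (rule Suc.hyps(1))
           (use Suc.hyps(2) Suc.prems(1) Suc.prems(2)[unfolded j' funpow_Suc_right o_apply] j' in auto)
      have "?k (\<rho> a v) = \<rho> (?h a) v + \<rho> a (?g v)"
        by (simp add: bilinear_simps[OF b] lie_rep_bracket[OF rep] algebra_simps)
      moreover have "i' + j = n" "i + j' = n" using Suc.hyps(2) i' j' by auto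
      ultimately have "(?k ^^ n) (?k (\<rho> a v)) = 0"
        using 1 2 by (simp add: endo_add[OF endo_funpow[OF endo_shift[OF e]]])
      then show ?thesis unfolding Suc.hyps(2)[symmetric] funpow_Suc_right o_apply .
    qed
  qed
  then show ?thesis unfolding gen_eigen_def by blast
qed

text \<open>For the adjoint representation this is the Killing form.\<close>

definition trace_form :: "('v \<Rightarrow> 'v \<Rightarrow> 'v) \<Rightarrow> 'v \<Rightarrow> 'v \<Rightarrow> complex" where
  "trace_form \<rho> x y = trace (\<lambda>v. \<rho> x (\<rho> y v))"

lemma trace_form_bilinear: "bilinear_product scale \<rho> \<Longrightarrow> bilinear_form (trace_form \<rho>)"
  unfolding trace_form_def by (rule bilinear_form_trace)

lemma trace_form_sym: "bilinear_product scale \<rho> \<Longrightarrow> trace_form \<rho> x y = trace_form \<rho> y x"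
  unfolding trace_form_def by (intro trace_commute bilinear_endo_right)

lemma trace_form_invariant:
  assumes rep: "lie_rep \<rho>"
  shows "trace_form \<rho> (bracket x y) z = trace_form \<rho> x (bracket y z)"
proof -
  note e = bilinear_endo_right[OF lie_rep_bilinear[OF rep]]
  note e3 = endo_compose[OF e endo_compose[OF e e]]
  have "trace (\<lambda>v. \<rho> y (\<rho> x (\<rho> z v))) = trace (\<lambda>v. \<rho> x (\<rho> z (\<rho> y v)))"
    by (rule trace_commute[OF e endo_compose[OF e e]])
  then show ?thesis
    unfolding trace_form_def lie_rep_bracket[OF rep]
    by (simp add: bilinear_simps[OF lie_rep_bilinear[OF rep]] trace_diff[OF e3 e3])
qed

abbreviation perfect :: bool where
  "perfect \<equiv> span {bracket x y |x y. True} = UNIV"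

text \<open>Brackets act by commutators, which have trace zero, and they span.\<close>

lemma trace_lie_rep:
  assumes rep: "lie_rep \<rho>" and perfect
  shows "trace (\<rho> x) = 0"
proof (rule trace_bilinear_eq_0[OF lie_rep_bilinear[OF rep]])
  note e = bilinear_endo_right[OF lie_rep_bilinear[OF rep]]
  show "x \<in> span {bracket x y |x y. True}" using \<open>perfect\<close> by simp
  show "trace (\<rho> z) = 0" if z: "z \<in> {bracket x y |x y. True}" for z
  proof -
    obtain x y where "z = bracket x y" using z by blast
    then have "\<rho> z = (\<lambda>v. \<rho> x (\<rho> y v) - \<rho> y (\<rho> x v))"
      using lie_rep_bracket[OF rep] by blast
    then show ?thesis
      using trace_commute[OF e e, of x y] trace_diff[OF endo_compose[OF e e] endo_compose[OF e e], of x y y x]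
      by simp
  qed
qed

text \<open>The heart of Cartan's criterion: pair \<open>\<rho> x\<close> with the operator that is multiplication by the
  conjugate eigenvalue on each generalized eigenspace, so that the trace becomes a sum of squares.\<close>

lemma cartan_nilpotent:
  assumes rep: "lie_rep \<rho>" and perfect and zero: "\<And>a b. trace_form \<rho> a b = 0"
  shows "gen_eigen (\<rho> x) 0 v"
proof -
  note b = lie_rep_bilinear[OF rep]
  note e = bilinear_endo_right[OF b]
  obtain y r where y: "endo y" and eig: "\<And>l v. gen_eigen (\<rho> x) l v \<Longrightarrow> y v = cnj l *s v"
    and tr: "trace (\<lambda>v. y (\<rho> x v)) = of_real r" and r0: "r = 0 \<longrightarrow> (\<forall>v. gen_eigen (\<rho> x) 0 v)"
    and sp: "UNIV \<subseteq> span {v. \<exists>l. gen_eigen (\<rho> x) l v}"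
    using conjugate_operator[OF e[of x] subspace_UNIV] by auto
  have spg: "UNIV \<subseteq> span {a. \<exists>m. gen_eigen (bracket x) m a}"
    using conjugate_operator[OF bilinear_endo_right[OF bracket_bilinear, of x] subspace_UNIV] by auto
  \<comment> \<open>Conjugation is additive on weights, so the commutator of \<open>y\<close> with
    \<open>\<rho> a\<close> is \<open>cnj m\<close> times \<open>\<rho> a\<close>. It suffices to
    check this on the spanning generalized eigenvectors.\<close>
  have comm: "y (\<rho> a v) = cnj m *s \<rho> a v + \<rho> a (y v)" if a: "gen_eigen (bracket x) m a" for m a v
  proof -
    let ?K = "{v. y (\<rho> a v) = cnj m *s \<rho> a v + \<rho> a (y v)}"
    have "subspace ?K"
      by (rule subspaceI)
         (simp_all add: bilinear_simps[OF b] endo_simps[OF y] scale_right_distrib mult.commute)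
    moreover have "{v. \<exists>l. gen_eigen (\<rho> x) l v} \<subseteq> ?K"
    proof clarify
      fix v l assume l: "gen_eigen (\<rho> x) l v"
      show "y (\<rho> a v) = cnj m *s \<rho> a v + \<rho> a (y v)"
        by (simp add: eig[OF l] eig[OF gen_eigen_lie_rep[OF rep a l]] bilinear_simps[OF b]
            scale_left_distrib)
    qed
    ultimately have "UNIV \<subseteq> ?K" using sp span_minimal by blast
    then show ?thesis by blast
  qed
  have t: "bilinear_product scale (\<lambda>z v. y (\<rho> z v))"
    by (intro bilinearI endo_compose[OF y] e bilinear_endo_left[OF b])
  \<comment> \<open>For \<open>a\<close> of weight \<open>m\<close> this trace is
    \<open>cnj m * trace_form \<rho> a c\<close>, which vanishes by hypothesis.\<close>
  have tab: "trace (\<lambda>v. y (\<rho> (bracket a c) v)) = 0" for a c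
  proof (rule trace_bilinear_eq_0[of "\<lambda>a v. y (\<rho> (bracket a c) v)"])
    show "bilinear_product scale (\<lambda>a v. y (\<rho> (bracket a c) v))"
      by (intro bilinearI endo_compose[OF y] e
            endo_compose[OF bilinear_endo_left[OF b] bilinear_endo_left[OF bracket_bilinear]])
    show "a \<in> span {a. \<exists>m. gen_eigen (bracket x) m a}" using spg by blast
    fix a assume "a \<in> {a. \<exists>m. gen_eigen (bracket x) m a}"
    then obtain m where a: "gen_eigen (bracket x) m a" by blast
    note ee = endo_compose[OF e e] and aya = endo_compose[OF e endo_compose[OF y e]]
      and yaa = endo_compose[OF y endo_compose[OF e e]]
    have "trace (\<lambda>v. y (\<rho> a (\<rho> c v))) = cnj m * trace_form \<rho> a c + trace (\<lambda>v. \<rho> a (y (\<rho> c v)))"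
      unfolding comm[OF a] trace_form_def
      using trace_add[OF endo_scaled[OF ee] aya] trace_scale[OF ee] by simp
    moreover have "trace (\<lambda>v. y (\<rho> c (\<rho> a v))) = trace (\<lambda>v. \<rho> a (y (\<rho> c v)))"
      by (rule trace_commute[OF endo_compose[OF y e] e])
    ultimately show "trace (\<lambda>v. y (\<rho> (bracket a c) v)) = 0"
      unfolding lie_rep_bracket[OF rep] endo_diff[OF y] trace_diff[OF yaa yaa] zero by simp
  qed
  have "trace (\<lambda>v. y (\<rho> x v)) = 0"
    by (rule trace_bilinear_eq_0[OF t, of "{bracket x y |x y. True}"]) (use tab \<open>perfect\<close> in auto)
  then show ?thesis using tr r0 by simp
qed

text \<open>If \<open>a\<close> has weight \<open>m\<close>, then \<open>\<rho> a v\<close> has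
  weight \<open>m\<close> as well as weight 0, so \<open>m = 0\<close> once
  \<open>\<rho> a v\<close> is nonzero. Thus \<open>bracket x\<close> has no nonzero weight.\<close>

lemma faithful_nilpotent_imp_ad_nilpotent:
  assumes rep: "lie_rep \<rho>" and faithful: "\<And>a. (\<And>v. \<rho> a v = 0) \<Longrightarrow> a = 0"
    and nil: "\<And>v. gen_eigen (\<rho> x) 0 v"
  shows "gen_eigen (bracket x) 0 a"
proof -
  have ex: "endo (bracket x)" by (rule bilinear_endo_right[OF bracket_bilinear])
  have "m = 0 \<or> a = 0" if "gen_eigen (bracket x) m a" for m a
  proof (rule disjCI)
    assume "a \<noteq> 0"
    then obtain v where "\<rho> a v \<noteq> 0" using faithful by blast
    then show "m = 0"
      using gen_eigen_disjoint[OF bilinear_endo_right[OF lie_rep_bilinear[OF rep]]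
          gen_eigen_lie_rep[OF rep that nil] nil] by auto
  qed
  then have "{a. \<exists>m. gen_eigen (bracket x) m a} \<subseteq> {a. gen_eigen (bracket x) 0 a}"
    using gen_eigen_zero by auto
  moreover have "UNIV \<subseteq> span {a. \<exists>m. gen_eigen (bracket x) m a}"
    using conjugate_operator[OF ex subspace_UNIV] by auto
  moreover have "subspace {a. gen_eigen (bracket x) 0 a}"
    by (rule subspaceI) (auto intro: gen_eigen_zero gen_eigen_add[OF ex] gen_eigen_scale[OF ex])
  ultimately show ?thesis using span_minimal by blast
qed

text \<open>Engel's theorem for \<open>H\<close> acting on the quotient of \<open>S\<close> by
  \<open>U\<close>, phrased without quotients. The relative form lets one induction hypothesis serve
  two modules: \<open>H\<close> modulo a maximal proper subalgebra \<open>M\<close>, and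
  \<open>S\<close> modulo \<open>U\<close>.\<close>

lemma engel:
  assumes nil: "\<And>x a. gen_eigen (bracket x) 0 a"
    and H: "subspace H" "\<And>x y. x \<in> H \<Longrightarrow> y \<in> H \<Longrightarrow> bracket x y \<in> H"
    and S: "subspace S" "\<And>x y. x \<in> H \<Longrightarrow> y \<in> S \<Longrightarrow> bracket x y \<in> S"
    and U: "subspace U" "\<And>x y. x \<in> H \<Longrightarrow> y \<in> U \<Longrightarrow> bracket x y \<in> U"
    and US: "U \<subset> S"
  shows "\<exists>v \<in> S - U. \<forall>x\<in>H. bracket x v \<in> U"
  using H S U US
proof (induction "dim H" arbitrary: H S U rule: less_induct)
  case less
  note H = less.prems(1,2) and S = less.prems(3,4) and U = less.prems(5,6) and US = less.prems(7)
  show ?case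
  proof (cases "H = {0}")
    case True
    then show ?thesis using US subspace_0[OF U(1)] by (auto simp: bracket_simps)
  next
    case False
    define P where "P M \<longleftrightarrow> subspace M \<and> (\<forall>x\<in>M. \<forall>y\<in>M. bracket x y \<in> M) \<and> M \<subset> H" for M
    have "P {0}" unfolding P_def using False subspace_0[OF H(1)] by (auto simp: bracket_simps)
    then obtain M where M: "P M" and maxM: "\<And>N. P N \<Longrightarrow> dim N \<le> dim M"
      using ex_has_greatest_nat[of P "{0}" dim "Suc dimension"] dim_subset_UNIV
      by (auto simp: less_Suc_eq_le)
    have subM: "subspace M" and clM: "\<And>x y. x \<in> M \<Longrightarrow> y \<in> M \<Longrightarrow> bracket x y \<in> M" and MH: "M \<subset> H"
      using M unfolding P_def by auto
    have dimM: "dim M < dim H"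
      using subspace_dim_equal[OF subM H(1)] MH by (metis not_less psubset_eq)
    \<comment> \<open>Applied to \<open>H\<close> modulo \<open>M\<close>, the induction hypothesis
      yields an element outside \<open>M\<close> that normalizes \<open>M\<close>.\<close>
    obtain z where z: "z \<in> H" "z \<notin> M" "\<And>x. x \<in> M \<Longrightarrow> bracket x z \<in> M"
      using less.hyps[OF dimM subM clM H(1) _ subM clM MH] H(2) MH by blast
    obtain v where v: "v \<in> S" "v \<notin> U" "\<And>x. x \<in> M \<Longrightarrow> bracket x v \<in> U"
      using less.hyps[OF dimM subM clM S(1) _ U(1) _ US] S(2) U(2) MH by blast
    \<comment> \<open>Since \<open>z\<close> normalizes \<open>M\<close>, this is a subalgebra
      larger than \<open>M\<close>, and maximality forces it to be \<open>H\<close>.\<close>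
    define N where "N = span (insert z M)"
    have N: "x \<in> N \<longleftrightarrow> (\<exists>k. x - k *s z \<in> M)" for x
      unfolding N_def span_breakdown_eq span_eq_iff[THEN iffD2, OF subM] ..
    have NH: "N \<subseteq> H" unfolding N_def using z(1) MH H(1) by (intro span_minimal) auto
    have "bracket x y \<in> N" if xy: "x \<in> N" "y \<in> N" for x y
    proof -
      obtain j k where jk: "x - j *s z \<in> M" "y - k *s z \<in> M" using xy N by blast
      let ?a = "x - j *s z" and ?c = "y - k *s z"
      have "bracket x y = bracket (?a + j *s z) (?c + k *s z)" by simp
      also have "\<dots> = bracket ?a ?c + (k *s bracket ?a z + j *s (- bracket ?c z))"
        unfolding bracket_simps(1,3,7,9) bracket_alternating
        by (simp add: bracket_antisym[of z ?c] del: add_diff_cancel diff_add_cancel)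
      also have "\<dots> \<in> M"
        by (intro subspace_add subspace_scale subspace_neg subM clM z(3) jk)
      finally show ?thesis unfolding N_def using span_base by blast
    qed
    moreover have "subspace N" unfolding N_def by simp
    moreover have "dim M < dim N"
      using z(2) unfolding N_def by (simp add: dim_insert span_eq_iff[THEN iffD2, OF subM])
    ultimately have NH': "N = H" using maxM[of N] NH unfolding P_def by (meson not_less psubsetI)
    \<comment> \<open>The lifts of the vectors of the quotient killed by \<open>M\<close>; stable
      under \<open>z\<close> because \<open>z\<close> normalizes \<open>M\<close>.\<close>
    let ?W = "{w \<in> S. \<forall>x\<in>M. bracket x w \<in> U}"
    have Wz: "bracket z w \<in> ?W" if w: "w \<in> ?W" for w
    proof -
      have "bracket x (bracket z w) \<in> U" if x: "x \<in> M" for x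
      proof -
        have "bracket x (bracket z w) = bracket (bracket x z) w + bracket z (bracket x w)"
          using lie_rep_bracket[OF lie_rep_adjoint, of x z w] by simp
        then show ?thesis using w x z U subspace_add[OF U(1)] by simp
      qed
      then show ?thesis using w S(2) z(1) by blast
    qed
    obtain n where n: "(bracket z ^^ n) v = 0" using nil[of z v] unfolding gen_eigen_def by auto
    \<comment> \<open>The iterate just before the orbit of \<open>v\<close> enters \<open>U\<close>
      is still outside \<open>U\<close>, and \<open>z\<close> sends it into
      \<open>U\<close>.\<close>
    define k where "k = (LEAST k. (bracket z ^^ k) v \<in> U)"
    have ex: "\<exists>k. (bracket z ^^ k) v \<in> U" using n subspace_0[OF U(1)] by metis
    have kU: "(bracket z ^^ k) v \<in> U" unfolding k_def using ex by (rule LeastI_ex)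
    then obtain j where j: "k = Suc j" using v(2) by (cases k) auto
    define w where "w = (bracket z ^^ j) v"
    have "w \<notin> U" unfolding w_def using not_less_Least[of j "\<lambda>k. (bracket z ^^ k) v \<in> U"] j k_def by simp
    moreover have "(bracket z ^^ i) v \<in> ?W" for i
      by (induction i) (use v Wz in auto)
    then have wW: "w \<in> ?W" unfolding w_def .
    moreover have zw: "bracket z w \<in> U" using kU unfolding w_def j by simp
    moreover have "bracket x w \<in> U" if x: "x \<in> H" for x
    proof -
      obtain k where k: "x - k *s z \<in> M" using x N NH' by blast
      have "bracket x w = bracket (x - k *s z) w + k *s bracket z w" by (simp add: bracket_simps)
      then show ?thesis using wW k zw subspace_add[OF U(1)] subspace_scale[OF U(1)] by simp
    qed
    ultimately show ?thesis by blast
  qed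
qed

end

section \<open>Consequences of simplicity for representations and trace forms\<close>

locale simple_complex_lie_algebra =
  complex_lie_algebra scale Basis bracket + simple_lie_algebra scale bracket
  for scale :: "complex \<Rightarrow> 'v::ab_group_add \<Rightarrow> 'v" (infixr "*s" 75) and Basis bracket
begin

lemma perfect: perfect
proof -
  let ?D = "span {bracket x y |x y. True}"
  have "bracket x y \<in> ?D" for x y by (rule span_base) blast
  then have "ideal ?D" unfolding ideal_def by simp
  moreover have "?D \<noteq> {0}" using nonabelian \<open>\<And>x y. bracket x y \<in> ?D\<close> by blast
  ultimately show ?thesis using ideal_trivial by blast
qed

text \<open>Otherwise Engel's theorem with \<open>U\<close> zero gives a nonzero central vector; the
  centre is an ideal, so the algebra would be abelian.\<close>

lemma not_ad_nilpotent: "\<exists>x a. \<not> gen_eigen (bracket x) 0 a"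
proof (rule ccontr)
  assume "\<not> ?thesis"
  then have nil: "\<And>x a. gen_eigen (bracket x) 0 a" by blast
  obtain v where v: "v \<noteq> 0" "\<And>x. bracket x v = 0"
    using engel[OF nil subspace_UNIV _ subspace_UNIV _ subspace_single_0] nonabelian
    by (auto simp: bracket_simps)
  let ?Z = "{v. \<forall>x. bracket x v = 0}"
  have "ideal ?Z"
    unfolding ideal_def by (auto intro!: subspaceI simp: bracket_simps)
  then have "?Z = UNIV" using ideal_trivial[of ?Z] v by auto
  then show False using nonabelian by auto
qed

lemma lie_rep_faithful:
  assumes rep: "lie_rep \<rho>" and nontrivial: "\<rho> a v \<noteq> 0" and x: "\<And>w. \<rho> x w = 0"
  shows "x = 0"
proof -
  let ?K = "{x. \<forall>w. \<rho> x w = 0}"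
  have "ideal ?K"
    unfolding ideal_def
    by (auto intro!: subspaceI simp: bilinear_simps[OF lie_rep_bilinear[OF rep]] lie_rep_bracket[OF rep])
  then have "?K = {0}" using ideal_trivial[of ?K] nontrivial by auto
  then show ?thesis using x by auto
qed

text \<open>The radical is an ideal by invariance. Were it everything,
  \<open>cartan_nilpotent\<close> would make each \<open>\<rho> x\<close> nilpotent, faithfulness
  would pass this to the adjoint action, and \<open>not_ad_nilpotent\<close> forbids that.\<close>

lemma trace_form_nondegenerate:
  assumes rep: "lie_rep \<rho>" and nontrivial: "\<rho> a v \<noteq> 0" and x: "\<And>y. trace_form \<rho> x y = 0"
  shows "x = 0"
proof -
  let ?K = "{x. \<forall>y. trace_form \<rho> x y = 0}"
  note f = trace_form_bilinear[OF lie_rep_bilinear[OF rep]]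
  have "trace_form \<rho> (bracket z x) y = 0" if "x \<in> ?K" for x y z
    using that bilinear_form_simps(7)[OF f, of "bracket x z" y]
    by (simp add: bracket_antisym[of z x] trace_form_invariant[OF rep])
  then have "ideal ?K"
    unfolding ideal_def by (auto intro!: subspaceI simp: bilinear_form_simps[OF f])
  moreover have "?K \<noteq> UNIV"
  proof
    assume "?K = UNIV"
    then have "trace_form \<rho> a b = 0" for a b by blast
    then have "gen_eigen (\<rho> x) 0 v" for x v by (rule cartan_nilpotent[OF rep perfect])
    then have "gen_eigen (bracket x) 0 a" for x a
      using faithful_nilpotent_imp_ad_nilpotent[OF rep lie_rep_faithful[OF rep nontrivial]] by blast
    then show False using not_ad_nilpotent by blast
  qed
  ultimately have "?K = {0}" using ideal_trivial by blast
  then show ?thesis using x by auto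
qed

end

section \<open>Post-Lie structures on a simple Lie algebra\<close>

locale simple_post_lie_structure =
  simple_complex_lie_algebra scale Basis bracket_g + post_lie_structure scale bracket_g bracket_n dot
  for scale :: "complex \<Rightarrow> 'v::ab_group_add \<Rightarrow> 'v" (infixr "*s" 75) and Basis bracket_g bracket_n dot
begin

sublocale n_complex: complex_lie_algebra scale Basis bracket_n
  by unfold_locales

lemmas dot_simps = bilinear_simps[OF dot_bilinear]
  and endo_dot = bilinear_endo_right[OF dot_bilinear]
  and endo_g = bilinear_endo_right[OF bracket_bilinear]
  and endo_n = bilinear_endo_right[OF n.bracket_bilinear]

section \<open>The two representations of \<open>g\<close> and their traces\<close>

lemma lie_rep_dot: "lie_rep dot"
  unfolding lie_rep_def using dot_bilinear dot_representation by blast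

lemma bracket_g_eq: "bracket_g x y = dot x y - dot y x + bracket_n x y"
  using dot_commutator[of x y] by simp

lemma bracket_n_jacobi: "bracket_n (bracket_n x y) v = bracket_n x (bracket_n y v) - bracket_n y (bracket_n x v)"
  by (rule n_complex.lie_rep_bracket[OF n_complex.lie_rep_adjoint])

text \<open>Expanding the commutator of the two sums, the cross terms are the adjoint actions of
  \<open>dot x y\<close> and \<open>- dot y x\<close> by \<open>dot_derivation\<close>; with
  \<open>bracket_n x y\<close> these add up to \<open>bracket_g x y\<close>.\<close>

lemma lie_rep_dot_plus_ad: "lie_rep (\<lambda>x v. dot x v + bracket_n x v)"
proof -
  have "dot (bracket_g x y) v + bracket_n (bracket_g x y) v =
      dot x (dot y v + bracket_n y v) + bracket_n x (dot y v + bracket_n y v)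
      - (dot y (dot x v + bracket_n x v) + bracket_n y (dot x v + bracket_n x v))" for x y v
    unfolding dot_representation
    by (simp add: bracket_g_eq[of x y] bracket_n_jacobi dot_simps n_complex.bracket_simps dot_derivation)
  moreover have "bilinear_product scale (\<lambda>x v. dot x v + bracket_n x v)"
    by (rule bilinearI[OF endo_plus[OF bilinear_endo_left[OF dot_bilinear]
            bilinear_endo_left[OF n.bracket_bilinear]] endo_plus[OF endo_dot endo_n]])
  ultimately show ?thesis unfolding lie_rep_def by (intro conjI allI)
qed

lemma trace_dot: "trace (dot x) = 0"
  by (rule trace_lie_rep[OF lie_rep_dot perfect])

lemma trace_bracket_n: "trace (bracket_n x) = 0"
  using trace_lie_rep[OF lie_rep_dot_plus_ad perfect, of x] trace_add[OF endo_dot endo_n, of x x]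
    trace_dot[of x] by simp

lemma trace_right_dot: "trace (\<lambda>x. dot x v) = 0"
proof -
  have "(\<lambda>x. dot x v) = (\<lambda>x. dot v x - bracket_g v x + bracket_n v x)"
    by (auto simp: bracket_g_eq)
  then have "trace (\<lambda>x. dot x v) = trace (dot v) - trace (bracket_g v) + trace (bracket_n v)"
    using trace_add[OF endo_minus[OF endo_dot endo_g] endo_n, of v v v]
      trace_diff[OF endo_dot endo_g, of v v] by simp
  then show ?thesis
    using trace_dot trace_bracket_n trace_lie_rep[OF lie_rep_adjoint perfect] by simp
qed

text \<open>The pairing \<open>F\<close> of the overview. No symmetry is available, since the
  arguments act through different products.\<close>

definition mixed_form :: "'v \<Rightarrow> 'v \<Rightarrow> complex" where
  "mixed_form x y = trace (\<lambda>v. dot x (bracket_n y v))"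

lemma mixed_form_bilinear: "bilinear_form mixed_form"
  unfolding mixed_form_def by (rule bilinear_form_trace[OF dot_bilinear n.bracket_bilinear])

text \<open>With dual bases \<open>b\<close>, \<open>e b\<close> for the trace form of \<open>dot\<close> and \<open>v = (\<Sum>b. dot b (e b))\<close>, invariance
  makes right multiplication by \<open>v\<close> equal to the Casimir operator plus the sum of the
  \<open>dot b \<circ> ad (e b)\<close>. Its trace vanishes, whereas the Casimir operator has trace \<open>dim \<noteq> 0\<close>.\<close>

lemma mixed_form_nonzero:
  assumes nontrivial: "dot a u \<noteq> 0"
  shows "\<exists>x y. mixed_form x y \<noteq> 0"
proof (rule ccontr)
  assume "\<not> ?thesis"
  then have zero: "\<And>x y. mixed_form x y = 0" by blast
  let ?\<beta> = "trace_form dot"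
  note inv = trace_form_invariant[OF lie_rep_dot]
  note \<beta> = trace_form_bilinear[OF dot_bilinear]
  obtain e where e: "\<forall>c\<in>Basis. ?\<beta> c (e c) = 1"
    "\<forall>x. (\<Sum>b\<in>Basis. ?\<beta> x (e b) *s b) = x" "\<forall>x. (\<Sum>b\<in>Basis. ?\<beta> b x *s e b) = x"
    using dual_basis_exists[OF \<beta> trace_form_sym[OF dot_bilinear]
        trace_form_nondegenerate[OF lie_rep_dot nontrivial]] by blast
  define v where "v = (\<Sum>b\<in>Basis. dot b (e b))"
  have "dot x v = (\<Sum>b\<in>Basis. dot b (dot (e b) x) + dot b (bracket_n (e b) x))" for x
  proof -
    \<comment> \<open>Invariance moves the bracket with \<open>x\<close> from the basis vectors to
      the dual ones, at the cost of a sign.\<close>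
    have "(\<Sum>b\<in>Basis. dot (bracket_g x b) (e b))
        = (\<Sum>b\<in>Basis. dot (\<Sum>c\<in>Basis. ?\<beta> (bracket_g x b) (e c) *s c) (e b))"
      using e(2) by simp
    also have "\<dots> = (\<Sum>b\<in>Basis. \<Sum>c\<in>Basis. - ?\<beta> b (bracket_g x (e c)) *s dot c (e b))"
    proof (intro sum.cong refl)
      fix b
      have "?\<beta> (bracket_g x b) c = - ?\<beta> b (bracket_g x c)" for c
        using bilinear_form_simps(7)[OF \<beta>, of "bracket_g b x" c]
        by (simp add: bracket_antisym[of x b] inv)
      then show "dot (\<Sum>c\<in>Basis. ?\<beta> (bracket_g x b) (e c) *s c) (e b)
          = (\<Sum>c\<in>Basis. - ?\<beta> b (bracket_g x (e c)) *s dot c (e b))"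
        by (simp add: dot_simps)
    qed
    also have "\<dots> = (\<Sum>c\<in>Basis. \<Sum>b\<in>Basis. - ?\<beta> b (bracket_g x (e c)) *s dot c (e b))"
      by (rule sum.swap)
    also have "\<dots> = (\<Sum>c\<in>Basis. - dot c (\<Sum>b\<in>Basis. ?\<beta> b (bracket_g x (e c)) *s e b))"
      by (simp add: dot_simps sum_negf)
    also have "\<dots> = (\<Sum>c\<in>Basis. - dot c (bracket_g x (e c)))"
      using e(3) by simp
    finally have "(\<Sum>b\<in>Basis. dot (bracket_g x b) (e b)) = (\<Sum>c\<in>Basis. - dot c (bracket_g x (e c)))" .
    moreover have "dot x v = (\<Sum>b\<in>Basis. dot (bracket_g x b) (e b)) + (\<Sum>b\<in>Basis. dot b (dot x (e b)))"
      by (simp add: v_def dot_simps dot_representation flip: sum.distrib)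
    ultimately have "dot x v = (\<Sum>b\<in>Basis. dot b (dot x (e b) - bracket_g x (e b)))"
      by (simp add: dot_simps sum_negf sum_subtractf)
    also have "\<dots> = (\<Sum>b\<in>Basis. dot b (dot (e b) x) + dot b (bracket_n (e b) x))"
    proof (intro sum.cong refl)
      fix b
      \<comment> \<open>Here \<open>x\<close> passes to the right argument, so both sides of the
        claim become operators applied to \<open>x\<close> and can be traced.\<close>
      have "dot x (e b) - bracket_g x (e b) = dot (e b) x + bracket_n (e b) x"
        using n_complex.bracket_antisym[of "e b" x] by (simp add: bracket_g_eq)
      then show "dot b (dot x (e b) - bracket_g x (e b)) = dot b (dot (e b) x) + dot b (bracket_n (e b) x)"
        by (simp add: dot_simps)
    qed
    finally show ?thesis .
  qed
  then have "trace (\<lambda>x. dot x v) = (\<Sum>b\<in>Basis. trace (\<lambda>x. dot b (dot (e b) x) + dot b (bracket_n (e b) x)))"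
    by (simp add: trace_sum endo_plus endo_compose[OF endo_dot endo_dot] endo_compose[OF endo_dot endo_n])
  also have "\<dots> = (\<Sum>b\<in>Basis. ?\<beta> b (e b) + mixed_form b (e b))"
    by (simp add: trace_form_def mixed_form_def
        trace_add[OF endo_compose[OF endo_dot endo_dot] endo_compose[OF endo_dot endo_n]])
  also have "\<dots> = of_nat (card Basis)" using e(1) zero by simp
  finally have "Basis = {}" using trace_right_dot finite_Basis by simp
  then have "(UNIV :: 'v set) = {0}" using span_Basis by simp
  then show False using nontrivial by blast
qed

text \<open>By cyclicity of the trace, \<open>bracket_g z\<close> on the left argument passes to the
  commutator of \<open>dot z\<close> with \<open>bracket_n y\<close> on the right;
  \<open>dot_derivation\<close> identifies this with \<open>bracket_n (dot z y)\<close>.\<close>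

lemma mixed_form_nondegenerate:
  assumes nontrivial: "dot a u \<noteq> 0" and x: "\<And>y. mixed_form x y = 0"
  shows "x = 0"
proof -
  let ?K = "{x. \<forall>y. mixed_form x y = 0}"
  have "mixed_form (bracket_g z x) y = - mixed_form x (dot z y)" for x y z
  proof -
    note e3 = endo_compose[OF endo_dot endo_compose[OF endo_dot endo_n]]
    note e3' = endo_compose[OF endo_dot endo_compose[OF endo_n endo_dot]]
    have "mixed_form (bracket_g z x) y
        = trace (\<lambda>v. dot z (dot x (bracket_n y v))) - trace (\<lambda>v. dot x (dot z (bracket_n y v)))"
      unfolding mixed_form_def dot_representation by (rule trace_diff[OF e3 e3])
    also have "trace (\<lambda>v. dot z (dot x (bracket_n y v))) = trace (\<lambda>v. dot x (bracket_n y (dot z v)))"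
      by (rule trace_commute[OF endo_dot endo_compose[OF endo_dot endo_n]])
    also have "\<dots> - trace (\<lambda>v. dot x (dot z (bracket_n y v)))
        = trace (\<lambda>v. dot x (bracket_n y (dot z v)) - dot x (dot z (bracket_n y v)))"
      by (rule trace_diff[symmetric, OF e3' e3])
    also have "\<dots> = trace (\<lambda>v. (-1) *s dot x (bracket_n (dot z y) v))"
      by (simp add: dot_derivation dot_simps)
    also have "\<dots> = - mixed_form x (dot z y)"
      unfolding mixed_form_def using trace_scale[OF endo_compose[OF endo_dot endo_n], of "-1"] by simp
    finally show ?thesis .
  qed
  then have "ideal ?K"
    unfolding ideal_def by (auto intro!: subspaceI simp: bilinear_form_simps[OF mixed_form_bilinear])
  moreover have "?K \<noteq> UNIV" using mixed_form_nonzero[OF nontrivial] by blast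
  ultimately have "?K = {0}" using ideal_trivial by blast
  then show ?thesis using x by auto
qed

section \<open>The Killing form of \<open>n\<close>, inner derivations and the isomorphism\<close>

abbreviation killing_n :: "'v \<Rightarrow> 'v \<Rightarrow> complex" where
  "killing_n \<equiv> n_complex.trace_form bracket_n"

lemma killing_n_nondegenerate:
  assumes nontrivial: "dot a u \<noteq> 0" and k: "\<And>y. killing_n k y = 0"
  shows "k = 0"
proof -
  have right: "y = 0" if "\<And>x. mixed_form x y = 0" for y
    using bilinear_form_nondegenerate_right[OF mixed_form_bilinear
        mixed_form_nondegenerate[OF nontrivial]] that by blast
  have "bracket_n y k = 0" for y
  proof (rule right)
    fix z
    note e3 = endo_compose[OF endo_dot endo_compose[OF endo_n endo_n]]
    note e3' = endo_compose[OF endo_n endo_compose[OF endo_dot endo_n]]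
    have "mixed_form z (bracket_n y k)
        = trace (\<lambda>v. dot z (bracket_n y (bracket_n k v))) - trace (\<lambda>v. dot z (bracket_n k (bracket_n y v)))"
      unfolding mixed_form_def bracket_n_jacobi dot_simps by (rule trace_diff[OF e3 e3])
    also have "trace (\<lambda>v. dot z (bracket_n k (bracket_n y v))) = trace (\<lambda>v. bracket_n y (dot z (bracket_n k v)))"
      by (rule trace_commute[OF endo_compose[OF endo_dot endo_n] endo_n])
    also have "trace (\<lambda>v. dot z (bracket_n y (bracket_n k v))) - \<dots>
        = trace (\<lambda>v. dot z (bracket_n y (bracket_n k v)) - bracket_n y (dot z (bracket_n k v)))"
      by (rule trace_diff[symmetric, OF e3 e3'])
    also have "\<dots> = killing_n (dot z y) k"
      by (simp add: dot_derivation n_complex.trace_form_def)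
    also have "\<dots> = 0" using k n_complex.trace_form_sym[OF n.bracket_bilinear] by metis
    finally show "mixed_form z (bracket_n y k) = 0" .
  qed
  then have "bracket_n k v = 0" for v using n_complex.bracket_antisym[of v k] by simp
  then show ?thesis by (intro right) (simp add: mixed_form_def dot_simps trace_zero)
qed

text \<open>The classical argument that derivations are inner when the Killing form is
  nondegenerate, carried out linearly in \<open>x\<close>.\<close>

lemma dot_inner:
  assumes nontrivial: "dot a u \<noteq> 0"
  obtains \<phi> where "endo \<phi>" "\<forall>x z. dot x z = bracket_n (\<phi> x) z"
proof -
  note \<kappa> = n_complex.trace_form_bilinear[OF n.bracket_bilinear]
  note nondeg = killing_n_nondegenerate[OF nontrivial]
  obtain e where e: "\<forall>x. (\<Sum>b\<in>Basis. killing_n b x *s e b) = x"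
    using dual_basis_exists[OF \<kappa> n_complex.trace_form_sym[OF n.bracket_bilinear] nondeg] by metis
  \<comment> \<open>As \<open>e\<close> is dual to \<open>Basis\<close> for the Killing form,
    \<open>\<phi> x\<close> represents the functional \<open>mixed_form x\<close>.\<close>
  define \<phi> where "\<phi> x = (\<Sum>b\<in>Basis. mixed_form x (e b) *s b)" for x
  have endo: "endo \<phi>"
    unfolding \<phi>_def
    by (rule endoI) (simp_all add: bilinear_form_simps[OF mixed_form_bilinear] scale_left_distrib
        sum.distrib scale_sum_right)
  have pair: "mixed_form x y = killing_n (\<phi> x) y" for x y
  proof -
    have "mixed_form x y = mixed_form x (\<Sum>b\<in>Basis. killing_n b y *s e b)" using e by simp
    then show ?thesis
      by (simp add: \<phi>_def bilinear_form_simps[OF mixed_form_bilinear] bilinear_form_simps[OF \<kappa>]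
          mult.commute)
  qed
  have "dot x z = bracket_n (\<phi> x) z" for x z
  proof -
    \<comment> \<open>\<open>E\<close> is a derivation of \<open>n\<close> trace-orthogonal to all
      inner ones. Since the adjoint action of \<open>E z\<close> is the commutator of
      \<open>E\<close> with that of \<open>z\<close>, pairing \<open>E z\<close> with
      \<open>y\<close> gives the trace of \<open>E\<close> against the action of
      \<open>bracket_n z y\<close>, which is zero.\<close>
    define E where "E v = dot x v - bracket_n (\<phi> x) v" for v
    have E: "endo E" unfolding E_def by (intro endo_minus endo_dot endo_n)
    have der: "bracket_n (E y) v = E (bracket_n y v) - bracket_n y (E v)" for y v
      by (simp add: E_def dot_derivation n_complex.bracket_simps bracket_n_jacobi)
    have tr: "trace (\<lambda>v. E (bracket_n y v)) = 0" for y
      using pair[of x y] trace_diff[OF endo_compose[OF endo_dot endo_n] endo_compose[OF endo_n endo_n]]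
      by (simp add: E_def mixed_form_def n_complex.trace_form_def)
    have "E z = 0"
    proof (rule nondeg)
      fix y
      note e3 = endo_compose[OF E endo_compose[OF endo_n endo_n]]
      note e3' = endo_compose[OF endo_n endo_compose[OF E endo_n]]
      have "killing_n (E z) y
          = trace (\<lambda>v. E (bracket_n z (bracket_n y v))) - trace (\<lambda>v. bracket_n z (E (bracket_n y v)))"
        unfolding n_complex.trace_form_def der by (rule trace_diff[OF e3 e3'])
      also have "trace (\<lambda>v. bracket_n z (E (bracket_n y v))) = trace (\<lambda>v. E (bracket_n y (bracket_n z v)))"
        by (rule trace_commute[OF endo_n endo_compose[OF E endo_n]])
      also have "trace (\<lambda>v. E (bracket_n z (bracket_n y v))) - \<dots>
          = trace (\<lambda>v. E (bracket_n (bracket_n z y) v))"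
        unfolding bracket_n_jacobi endo_diff[OF E] by (rule trace_diff[symmetric, OF e3 e3])
      also have "\<dots> = 0" by (rule tr)
      finally show "killing_n (E z) y = 0" .
    qed
    then show ?thesis by (simp add: E_def)
  qed
  with endo that show ?thesis by blast
qed

lemma isomorphic: "lie_algebra_isomorphic scale bracket_n scale bracket_g"
proof (cases "\<forall>x y. dot x y = 0")
  case True
  then have "bracket_n x y = bracket_g x y" for x y by (simp add: bracket_g_eq)
  then show ?thesis
    unfolding lie_algebra_isomorphic_def using endo_ident
    by (intro exI[of _ "\<lambda>x. x"]) (simp add: bij_id[unfolded id_def])
next
  case False
  then obtain a u where nontrivial: "dot a u \<noteq> 0" by blast
  obtain \<phi> where \<phi>: "endo \<phi>" "\<forall>x z. dot x z = bracket_n (\<phi> x) z"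
    using dot_inner[OF nontrivial] .
  have "x = 0" if "\<phi> x = 0" for x
    using lie_rep_faithful[OF lie_rep_dot nontrivial, of x] \<phi>(2) that
    by (simp add: n_complex.bracket_simps)
  then have inj: "inj \<phi>" unfolding module_hom.inj_iff_eq_0[OF endo_module_hom[OF \<phi>(1)]] by blast
  have surj: "surj \<phi>" by (rule linear_inj_imp_surj[OF \<phi>(1) inj])
  have hom: "\<phi> (bracket_g x y) = bracket_n (\<phi> x) (\<phi> y)" for x y
  proof -
    \<comment> \<open>Both terms act on \<open>n\<close> as the commutator of \<open>dot x\<close>
      and \<open>dot y\<close>, so the difference acts as zero and lies in the Killing
      radical.\<close>
    let ?d = "\<phi> (bracket_g x y) - bracket_n (\<phi> x) (\<phi> y)"
    have "bracket_n ?d v = 0" for v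
      using dot_representation[of x y v] \<phi>(2) bracket_n_jacobi[of "\<phi> x" "\<phi> y" v]
      by (simp add: n_complex.bracket_simps)
    then have "?d = 0"
      by (intro killing_n_nondegenerate[OF nontrivial]) (simp add: n_complex.trace_form_def trace_zero)
    then show ?thesis by simp
  qed
  \<comment> \<open>\<open>\<phi>\<close> goes from \<open>g\<close> to \<open>n\<close>, whereas
    the goal asks for the opposite direction.\<close>
  have "inv \<phi> (bracket_n x y) = bracket_g (inv \<phi> x) (inv \<phi> y)" for x y
    using hom[of "inv \<phi> x" "inv \<phi> y"] inj surj by (simp add: surj_f_inv_f inv_f_eq)
  moreover have "endo (inv \<phi>)" by (rule inj_linear_imp_inv_linear[OF \<phi>(1) inj])
  moreover have "bij (inv \<phi>)" using inj surj bij_imp_bij_inv bij_def by blast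
  ultimately show ?thesis unfolding lie_algebra_isomorphic_def by blast
qed

end

theorem theorem3p1:
  fixes scale :: "complex \<Rightarrow> 'v::ab_group_add \<Rightarrow> 'v"
    and Basis :: "'v set"
    and bracket_g bracket_n :: "'v \<Rightarrow> 'v \<Rightarrow> 'v"
  assumes "finite_dimensional_vector_space scale Basis"
    and "simple_lie_algebra scale bracket_g"
    and "lie_algebra scale bracket_n"
    and "\<exists>dot. post_lie_structure scale bracket_g bracket_n dot"
  shows "lie_algebra_isomorphic scale bracket_n scale bracket_g"
proof -
  obtain dot where "post_lie_structure scale bracket_g bracket_n dot" using assms(4) by blast
  with assms(1,2) have "simple_post_lie_structure scale Basis bracket_g bracket_n dot"
    by (intro simple_post_lie_structure.intro simple_complex_lie_algebra.intro
        complex_lie_algebra.intro finite_dimensional_complex_space.intro)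
       (simp_all add: simple_lie_algebra_def)
  then show ?thesis by (rule simple_post_lie_structure.isomorphic)
qed

end
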